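(* For each $n\ge 2$ let $r=r_n\in[0,1/2]$ and let $\mathcal{G}_n=\{G_{ij}\}_{1\le i<j\le n}$ be a centered Gaussian field with $$\mathbb{E}(G_{ij}G_{kl})=\begin{cases}0 & \text{if } |\{i,j\}\cap\{k,l\}|=0,\\ r_n & \text{if } |\{i,j\}\cap\{k,l\}|=1,\\ 1 & \text{if } |\{i,j\}\cap\{k,l\}|=2.\end{cases}$$ Suppose that $(1-2r_n)\log n\to 0$. Then, as $n\to\infty$, $$c_n\left(\max_{1\le i<j\le n}G_{ij}-\sqrt{2}\,d_n\right)\xrightarrow{d}\frac{\eta_1+\eta_2}{\sqrt{2}}.$$
   Context: $c_n:=\sqrt{2\log n}$ and $d_n:=\sqrt{2\log n}-\frac{\log\log n+\log(4\pi)}{2\sqrt{2\log n}}$. Let $\{\zeta_k\}_{k\ge1}$ be i.i.d. standard exponential random variables and $\eta_i:=-\log\left(\sum_{k=1}^i\zeta_k\right)$, $i\ge1$ (so $\eta_1>\eta_2$ are the two largest points of a Poisson point process with intensity $e^{-x}\,dx$). *)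

theory Defs
  imports "HOL-Probability.Probability"
begin

definition c_seq :: "nat \<Rightarrow> real" where
  "c_seq n = sqrt (2 * ln (real n))"

definition d_seq :: "nat \<Rightarrow> real" where
  "d_seq n = sqrt (2 * ln (real n))
     - (ln (ln (real n)) + ln (4 * pi)) / (2 * sqrt (2 * ln (real n)))"

definition pairs :: "nat \<Rightarrow> (nat \<times> nat) set" where
  "pairs n = {(i, j). 1 \<le> i \<and> i < j \<and> j \<le> n}"

definition cov_r :: "real \<Rightarrow> nat \<times> nat \<Rightarrow> nat \<times> nat \<Rightarrow> real" where
  "cov_r r p q =
    (let s = card ({fst p, snd p} \<inter> {fst q, snd q}) in
     if s = 0 then 0 else if s = 1 then r else 1)"

text \<open>A centered Gaussian field indexed by a finite set I with covariance C: all X i are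
  real random variables and the joint characteristic function is that of a centered
  Gaussian vector with covariance C.\<close>
definition centered_gaussian_field ::
  "'a measure \<Rightarrow> 'i set \<Rightarrow> ('i \<Rightarrow> 'a \<Rightarrow> real) \<Rightarrow> ('i \<Rightarrow> 'i \<Rightarrow> real) \<Rightarrow> bool" where
  "centered_gaussian_field M I X C \<longleftrightarrow>
     (\<forall>i\<in>I. X i \<in> borel_measurable M) \<and>
     (\<forall>a :: 'i \<Rightarrow> real.
        (LINT \<omega>|M. cis (\<Sum>i\<in>I. a i * X i \<omega>))
          = complex_of_real (exp (- (\<Sum>i\<in>I. \<Sum>j\<in>I. a i * a j * C i j) / 2)))"

end

(*
The field has the same law as sqrt r * (X_i + X_j) + sqrt (1 - 2 r) * Z_ij with independent
standard normals X_i, Z_ij. With Y_i = c_n (X_i - d_n), the event that all Y_i + Y_j are at most z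
splits according to whether no Y_i exceeds z/2 or exactly one does; this expresses its probability
through the normal distribution function, and dominated convergence gives the law of eta_1 + eta_2.
The noise Z is negligible. For the lower tail of the maximum, condition on X and look only at a pair
with a large X-sum. For the upper tail, take a union bound over all pairs, after discarding the
unlikely event that some Y_i exceeds K: without this truncation the first moment diverges. Bounding
the noise by an exponential moment at rate of order c_n makes the truncated sum factorise over the
two endpoints of a pair.
*)
theory Submission
  imports Defs "HOL-Real_Asymp.Real_Asymp"
begin

text \<open>The hypothesis enters through c_n^2 (1 - 2r) = 2 (1 - 2r) log n -> 0, in two ways. The
  noise has variance 1 - 2r, so its exponential moment at a rate of order c_n stays bounded. The
  vertex part has the factor sqrt r instead of 1/sqrt 2, and as d_n is of order c_n, this displaces
  the rescaled maximum by an amount of order c_n^2 (1 - sqrt (2r)), which is at most c_n^2 (1 - 2r).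
  The plain first moment diverges because the expected number of pairs with Y_i + Y_j near z is an
  integral of e^{-y} e^{-(z-y)} over y: the integrand does not depend on y, and the Gaussian
  corrections cut it off only at |y| of order c_n. The many contributing pairs combine a very high
  with a very low coordinate, although very high coordinates are improbable. After truncation at K a
  one-point weight e^{2y} is affordable: its rate 2 exceeds the decay rate 1 of the intensity
  e^{-y}, so low coordinates contribute a finite amount. The field is specified through its joint
  characteristic function alone, so its replacement by the explicit model rests on a uniqueness
  theorem for box probabilities, derived from the one-dimensional one.\<close>

section \<open>Uniqueness of joint characteristic functions\<close>

text \<open>Dividing both weights by their common mean \<open>m\<close> gives probability densities;
  the images under \<open>X\<close> and \<open>Y\<close> then have the same characteristic function
  and Levy uniqueness applies. The lower bound 1 keeps \<open>m\<close> away from 0.\<close>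

lemma weighted_char_unique:
  fixes X :: "'a \<Rightarrow> real" and Y :: "'b \<Rightarrow> real"
  assumes M: "prob_space M" and N: "prob_space N"
    and [measurable]: "X \<in> borel_measurable M" "Y \<in> borel_measurable N"
      "w \<in> borel_measurable M" "v \<in> borel_measurable N"
    and w: "\<And>x. 1 \<le> w x \<and> w x \<le> (C::real)" and v: "\<And>x. 1 \<le> v x \<and> v x \<le> C"
    and cf: "\<And>t. (LINT x|M. of_real (w x) * cis (t * X x)) = (LINT x|N. of_real (v x) * cis (t * Y x))"
    and A: "A \<in> sets borel"
  shows "(LINT x|M. w x * indicator A (X x)) = (LINT x|N. v x * indicator A (Y x))"
proof -
  interpret M: prob_space M by fact
  interpret N: prob_space N by fact
  have nw: "\<bar>w x\<bar> \<le> C" "\<bar>v y\<bar> \<le> C" for x y using w[of x] v[of y] by auto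
  have iw: "integrable M w" by (rule M.integrable_const_bound[of _ C]) (auto simp: nw)
  have iv: "integrable N v" by (rule N.integrable_const_bound[of _ C]) (auto simp: nw)
  define m where "m = (LINT x|M. w x)"
  \<comment> \<open>Frequency 0 says that the two total masses agree, so one constant normalises
    both sides.\<close>
  have mN: "m = (LINT x|N. v x)"
    using cf[of 0] unfolding m_def by simp
  have m1: "m \<ge> 1"
    using M.integral_ge_const[OF iw, of 1] w by (auto simp: m_def)
  define M' where "M' = distr (density M (\<lambda>x. ennreal (w x / m))) borel X"
  define N' where "N' = distr (density N (\<lambda>x. ennreal (v x / m))) borel Y"
  have pos: "w x / m \<ge> 0" "v y / m \<ge> 0" for x y using w[of x] v[of y] m1 by auto
  have pM: "prob_space (density M (\<lambda>x. ennreal (w x / m)))"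
  proof (rule prob_spaceI)
    have "emeasure (density M (\<lambda>x. ennreal (w x / m))) (space M) = (\<integral>\<^sup>+x. ennreal (w x / m) \<partial>M)"
      by (subst emeasure_density) (auto intro!: nn_integral_cong)
    also have "\<dots> = ennreal (LINT x|M. w x / m)"
      using pos iw by (intro nn_integral_eq_integral) auto
    finally show "emeasure (density M (\<lambda>x. ennreal (w x / m))) (space (density M (\<lambda>x. ennreal (w x / m)))) = 1"
      using m1 by (simp add: m_def[symmetric])
  qed
  have pN: "prob_space (density N (\<lambda>x. ennreal (v x / m)))"
  proof (rule prob_spaceI)
    have "emeasure (density N (\<lambda>x. ennreal (v x / m))) (space N) = (\<integral>\<^sup>+x. ennreal (v x / m) \<partial>N)"
      by (subst emeasure_density) (auto intro!: nn_integral_cong)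
    also have "\<dots> = ennreal (LINT x|N. v x / m)"
      using pos iv by (intro nn_integral_eq_integral) auto
    finally show "emeasure (density N (\<lambda>x. ennreal (v x / m))) (space (density N (\<lambda>x. ennreal (v x / m)))) = 1"
      using m1 by (simp add: mN[symmetric])
  qed
  have rM: "real_distribution M'" unfolding M'_def
    by (intro prob_space.real_distribution_distr[OF pM]) simp
  have rN: "real_distribution N'" unfolding N'_def
    by (intro prob_space.real_distribution_distr[OF pN]) simp
  have "char M' t = char N' t" for t
  proof -
    have "char M' t = (LINT x|M. (w x / m) *\<^sub>R cis (t * X x))"
      unfolding char_def M'_def
      by (subst integral_distr; (subst integral_density)?) (use pos in \<open>auto simp: cis_conv_exp\<close>)
    also have "\<dots> = (LINT x|M. of_real (w x) * cis (t * X x)) / of_real m"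
      by (simp add: scaleR_conv_of_real field_simps flip: integral_divide_zero)
    also have "\<dots> = (LINT x|N. of_real (v x) * cis (t * Y x)) / of_real m"
      by (simp add: cf)
    also have "\<dots> = (LINT x|N. (v x / m) *\<^sub>R cis (t * Y x))"
      by (simp add: scaleR_conv_of_real field_simps flip: integral_divide_zero)
    also have "\<dots> = char N' t"
      unfolding char_def N'_def
      by (subst integral_distr; (subst integral_density)?) (use pos in \<open>auto simp: cis_conv_exp\<close>)
    finally show ?thesis .
  qed
  hence eq: "M' = N'" by (intro Levy_uniqueness rM rN ext)
  have "(LINT x|M'. indicator A x) = (LINT x|M. (w x / m) * indicator A (X x))"
    unfolding M'_def using A
    by (subst integral_distr; (subst integral_density)?) (use pos in auto)
  moreover have "(LINT x|N'. indicator A x) = (LINT x|N. (v x / m) * indicator A (Y x))"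
    unfolding N'_def using A
    by (subst integral_distr; (subst integral_density)?) (use pos in auto)
  ultimately show ?thesis using m1 by (simp add: eq)
qed

lemma borel_measurable_cis [measurable]: "cis \<in> borel_measurable borel"
  by (intro borel_measurable_continuous_onI continuous_intros)

text \<open>The weight \<open>2 + Re (g x)\<close> lies between 1 and 3 and is thus admissible for
  \<open>weighted_char_unique\<close>. Writing Re as half the sum of \<open>g\<close> and its
  conjugate moves the conjugation onto the frequency, so only integrals of \<open>g\<close> against
  \<open>cis\<close> at t and -t remain.\<close>

lemma (in prob_space) expectation_Re_weight_cis:
  fixes g :: "'a \<Rightarrow> complex"
  assumes [measurable]: "X \<in> borel_measurable M" "g \<in> borel_measurable M" and g: "\<And>x. norm (g x) \<le> 1"
  shows "(LINT x|M. of_real (2 + Re (g x)) * cis (t * X x)) =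
    2 * (LINT x|M. cis (t * X x)) + ((LINT x|M. g x * cis (t * X x)) + cnj (LINT x|M. g x * cis ((-t) * X x))) / 2"
proof -
  have i: "integrable M (\<lambda>x. cis (t * X x))" "integrable M (\<lambda>x. g x * cis (t * X x))"
    "integrable M (\<lambda>x. g x * cis ((-t) * X x))"
    using g by (auto intro!: integrable_const_bound[of _ 1] simp: norm_mult)
  note i = i(1,2) integrable_cnj[OF i(3)]
  have "(LINT x|M. of_real (2 + Re (g x)) * cis (t * X x)) =
     (LINT x|M. 2 * cis (t * X x) + (g x * cis (t * X x) + cnj (g x * cis ((-t) * X x))) / 2)"
    by (intro Bochner_Integration.integral_cong) (auto simp: complex_eq_iff field_simps)
  also have "\<dots> = 2 * (LINT x|M. cis (t * X x)) + ((LINT x|M. g x * cis (t * X x)) + (LINT x|M. cnj (g x * cis ((-t) * X x)))) / 2"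
    using i by simp
  also have "(LINT x|M. cnj (g x * cis ((-t) * X x))) = cnj (LINT x|M. g x * cis ((-t) * X x))"
    by (rule Bochner_Integration.integral_cnj)
  finally show ?thesis .
qed

text \<open>The positive weights \<open>2 + Re (\<gamma> * g x)\<close> reduce this to the real
  case; the summand 2 is removed again with the unweighted identity \<open>one\<close>. The values 1
  and -i of \<open>\<gamma>\<close> recover the real and the imaginary part.\<close>

lemma complex_weighted_char_unique:
  fixes X :: "'a \<Rightarrow> real" and Y :: "'b \<Rightarrow> real" and g :: "'a \<Rightarrow> complex" and h :: "'b \<Rightarrow> complex"
  assumes M: "prob_space M" and N: "prob_space N"
    and [measurable]: "X \<in> borel_measurable M" "Y \<in> borel_measurable N"
      "g \<in> borel_measurable M" "h \<in> borel_measurable N"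
    and g: "\<And>x. norm (g x) \<le> 1" and h: "\<And>x. norm (h x) \<le> 1"
    and cf: "\<And>t. (LINT x|M. g x * cis (t * X x)) = (LINT x|N. h x * cis (t * Y x))"
    and cf1: "\<And>t. (LINT x|M. cis (t * X x)) = (LINT x|N. cis (t * Y x))"
    and A: "A \<in> sets borel"
  shows "(LINT x|M. g x * indicator A (X x)) = (LINT x|N. h x * indicator A (Y x))"
proof -
  interpret M: prob_space M by fact
  interpret N: prob_space N by fact
  have iM: "integrable M f" if [measurable]: "f \<in> borel_measurable M" and "\<And>x. norm (f x) \<le> 3" for f :: "'a \<Rightarrow> complex"
    using that by (intro M.integrable_const_bound[of _ 3]) auto
  have iN: "integrable N f" if [measurable]: "f \<in> borel_measurable N" and "\<And>x. norm (f x) \<le> 3" for f :: "'b \<Rightarrow> complex"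
    using that by (intro N.integrable_const_bound[of _ 3]) auto
  have iMr: "integrable M f" if [measurable]: "f \<in> borel_measurable M" and "\<And>x. norm (f x) \<le> 3" for f :: "'a \<Rightarrow> real"
    using that by (intro M.integrable_const_bound[of _ 3]) auto
  have iNr: "integrable N f" if [measurable]: "f \<in> borel_measurable N" and "\<And>x. norm (f x) \<le> 3" for f :: "'b \<Rightarrow> real"
    using that by (intro N.integrable_const_bound[of _ 3]) auto
  have one: "(LINT x|M. indicator A (X x)::real) = (LINT x|N. indicator A (Y x))"
  proof -
    have "(LINT x|M. 1 * indicator A (X x)) = (LINT x|N. 1 * indicator A (Y x)::real)"
      by (rule weighted_char_unique[OF M N, where C=1]) (use A cf1 in auto)
    thus ?thesis by simp
  qed
  have real_part: "(LINT x|M. Re (\<gamma> * g x) * indicator A (X x)) = (LINT x|N. Re (\<gamma> * h x) * indicator A (Y x))"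
    if \<gamma>: "norm \<gamma> = 1" for \<gamma>
  proof -
    have ng: "norm (\<gamma> * g x) \<le> 1" "norm (\<gamma> * h y) \<le> 1" for x y
      using g[of x] h[of y] \<gamma> by (auto simp: norm_mult)
    have bd: "\<bar>Re (\<gamma> * g x)\<bar> \<le> 1" "\<bar>Re (\<gamma> * h y)\<bar> \<le> 1" for x y
      using ng(1)[of x] ng(2)[of y] abs_Re_le_cmod order_trans by blast+
    have "(LINT x|M. (2 + Re (\<gamma> * g x)) * indicator A (X x)) = (LINT x|N. (2 + Re (\<gamma> * h x)) * indicator A (Y x))"
    proof (rule weighted_char_unique[OF M N, where C=3])
      fix t :: real
      have e: "(LINT x|M. \<gamma> * g x * cis (s * X x)) = (LINT x|N. \<gamma> * h x * cis (s * Y x))" for s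
        using cf[of s] by (simp add: mult.assoc)
      show "(LINT x|M. of_real (2 + Re (\<gamma> * g x)) * cis (t * X x)) = (LINT x|N. of_real (2 + Re (\<gamma> * h x)) * cis (t * Y x))"
        using ng by (subst M.expectation_Re_weight_cis, simp, simp, simp)
          (subst N.expectation_Re_weight_cis, simp, simp, simp, simp only: e cf1)
    next
      show "1 \<le> 2 + Re (\<gamma> * g x) \<and> 2 + Re (\<gamma> * g x) \<le> 3" for x using bd(1)[of x] by linarith
      show "1 \<le> 2 + Re (\<gamma> * h x) \<and> 2 + Re (\<gamma> * h x) \<le> 3" for x using bd(2)[of x] by linarith
    qed (use A in auto)
    moreover have "(LINT x|M. (2 + Re (\<gamma> * g x)) * indicator A (X x)) =
        2 * (LINT x|M. indicator A (X x)) + (LINT x|M. Re (\<gamma> * g x) * indicator A (X x))"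
      using A bd by (simp only: distrib_right, subst Bochner_Integration.integral_add)
        (auto intro!: iMr simp: indicator_def intro: order_trans[of _ 1])
    moreover have "(LINT x|N. (2 + Re (\<gamma> * h x)) * indicator A (Y x)) =
        2 * (LINT x|N. indicator A (Y x)) + (LINT x|N. Re (\<gamma> * h x) * indicator A (Y x))"
      using A bd by (simp only: distrib_right, subst Bochner_Integration.integral_add)
        (auto intro!: iNr simp: indicator_def intro: order_trans[of _ 1])
    ultimately show ?thesis using one by simp
  qed
  have im: "integrable M (\<lambda>x. g x * indicator A (X x))" "integrable N (\<lambda>x. h x * indicator A (Y x))"
    using A g h by (auto intro!: iM iN simp: indicator_def norm_mult intro: order_trans[of _ 1])
  have Re_ind: "Re (1 * z) * indicator A s = Re (z * indicator A s)" "Re (-\<i> * z) * indicator A s = Im (z * indicator A s)" for z s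
    by (auto simp: indicator_def)
  show ?thesis
    using real_part[of 1] real_part[of "-\<i>"] im unfolding Re_ind
    by (intro complex_eqI) (simp_all only: integral_Re[symmetric] integral_Im[symmetric] norm_one norm_minus_cancel norm_ii)
qed

text \<open>One coordinate at a time is converted from frequency to indicator. Keeping the frequency
  vector \<open>a\<close> arbitrary makes the induction run: raising its k-th entry by t turns the
  induction hypothesis into a statement on the characteristic function of \<open>X k\<close> under
  the complex weight \<open>g\<close>, the setting of
  \<open>complex_weighted_char_unique\<close>.\<close>

lemma joint_char_unique_aux:
  fixes X :: "'i \<Rightarrow> 'a \<Rightarrow> real" and Y :: "'i \<Rightarrow> 'b \<Rightarrow> real"
  assumes M: "prob_space M" and N: "prob_space N" and I: "finite I"
    and X: "\<And>i. i \<in> I \<Longrightarrow> X i \<in> borel_measurable M" and Y: "\<And>i. i \<in> I \<Longrightarrow> Y i \<in> borel_measurable N"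
    and cf: "\<And>a. (LINT x|M. cis (\<Sum>i\<in>I. a i * X i x)) = (LINT x|N. cis (\<Sum>i\<in>I. a i * Y i x))"
    and A: "\<And>i. i \<in> I \<Longrightarrow> A i \<in> sets borel" and J: "J \<subseteq> I"
  shows "(LINT x|M. cis (\<Sum>i\<in>I. a i * X i x) * (\<Prod>j\<in>J. indicator (A j) (X j x)))
       = (LINT x|N. cis (\<Sum>i\<in>I. a i * Y i x) * (\<Prod>j\<in>J. indicator (A j) (Y j x)))"
  using finite_subset[OF J I] J
proof (induction J arbitrary: a rule: finite_induct)
  case empty
  then show ?case using cf by simp
next
  case (insert k J)
  note [measurable] = X Y A
  have k: "k \<in> I" and JI: "J \<subseteq> I" using insert.prems by auto
  define g where "g x = cis (\<Sum>i\<in>I. a i * X i x) * (\<Prod>j\<in>J. indicator (A j) (X j x))" for x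
  define h where "h x = cis (\<Sum>i\<in>I. a i * Y i x) * (\<Prod>j\<in>J. indicator (A j) (Y j x))" for x
  have upd: "(\<Sum>i\<in>I. (a(k := a k + t)) i * f i) = (\<Sum>i\<in>I. a i * f i) + t * f k" for a t and f :: "'i \<Rightarrow> real"
    using I k by (simp add: sum.remove[of I k] algebra_simps)
  have nm: "norm (\<Prod>j\<in>J. indicator (B j) (f j) :: complex) \<le> 1" for B and f :: "'i \<Rightarrow> real"
    by (auto simp: prod_norm[symmetric] indicator_def intro!: prod_le_1)
  have AJ: "A j \<in> sets borel" if "j \<in> J" for j using A JI that by auto
  have XJ: "X j \<in> borel_measurable M" "Y j \<in> borel_measurable N" if "j \<in> J" for j using X Y JI that by auto
  note [measurable] = AJ XJ
  have Xk[measurable]: "X k \<in> borel_measurable M" "Y k \<in> borel_measurable N" "A k \<in> sets borel" using X Y A k by auto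
  have gm[measurable]: "g \<in> borel_measurable M" unfolding g_def cis_conv_exp
    by (intro borel_measurable_times borel_measurable_prod) (measurable, measurable)
  have hm[measurable]: "h \<in> borel_measurable N" unfolding h_def cis_conv_exp
    by (intro borel_measurable_times borel_measurable_prod) (measurable, measurable)
  have "(LINT x|M. g x * indicator (A k) (X k x)) = (LINT x|N. h x * indicator (A k) (Y k x))"
  proof (rule complex_weighted_char_unique[OF M N])
    fix t :: real
    have "g x * cis (t * X k x) = cis (\<Sum>i\<in>I. (a(k := a k + t)) i * X i x) * (\<Prod>j\<in>J. indicator (A j) (X j x))" for x
      unfolding g_def upd[where a=a and t=t and f="\<lambda>i. X i x"] by (simp only: cis_mult[symmetric] mult_ac)
    moreover have "h x * cis (t * Y k x) = cis (\<Sum>i\<in>I. (a(k := a k + t)) i * Y i x) * (\<Prod>j\<in>J. indicator (A j) (Y j x))" for x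
      unfolding h_def upd[where a=a and t=t and f="\<lambda>i. Y i x"] by (simp only: cis_mult[symmetric] mult_ac)
    ultimately show "(LINT x|M. g x * cis (t * X k x)) = (LINT x|N. h x * cis (t * Y k x))"
      using insert.IH[OF JI] by simp
    \<comment> \<open>With all frequencies zero except the k-th, \<open>cf\<close> is the marginal
      identity for coordinate k.\<close>
    show "(LINT x|M. cis (t * X k x)) = (LINT x|N. cis (t * Y k x))"
      using cf[of "(\<lambda>_. 0)(k := 0 + t)"] upd[where a="\<lambda>_. 0" and t=t] by simp
    show "norm (g x) \<le> 1" for x unfolding g_def using nm by (simp add: norm_mult)
    show "norm (h x) \<le> 1" for x unfolding h_def using nm by (simp add: norm_mult)
  qed measurable
  then show ?case
    using insert.hyps by (simp add: g_def h_def mult_ac)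
qed

text \<open>The case \<open>J = I\<close>, \<open>a = 0\<close> of the preceding induction. Boxes
  are enough for a maximum, which is at most u exactly when every coordinate is.\<close>

lemma joint_char_unique:
  fixes X :: "'i \<Rightarrow> 'a \<Rightarrow> real" and Y :: "'i \<Rightarrow> 'b \<Rightarrow> real"
  assumes M: "prob_space M" and N: "prob_space N" and I: "finite I"
    and X: "\<And>i. i \<in> I \<Longrightarrow> X i \<in> borel_measurable M" and Y: "\<And>i. i \<in> I \<Longrightarrow> Y i \<in> borel_measurable N"
    and cf: "\<And>a. (LINT x|M. cis (\<Sum>i\<in>I. a i * X i x)) = (LINT x|N. cis (\<Sum>i\<in>I. a i * Y i x))"
    and A: "\<And>i. i \<in> I \<Longrightarrow> A i \<in> sets borel"
  shows "measure M {x \<in> space M. \<forall>i\<in>I. X i x \<in> A i} = measure N {x \<in> space N. \<forall>i\<in>I. Y i x \<in> A i}"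
proof -
  interpret M: prob_space M by fact
  interpret N: prob_space N by fact
  have p: "(\<Prod>j\<in>I. indicator (A j) (f j)) = (indicator {x. \<forall>i\<in>I. x i \<in> A i} f :: complex)" for f :: "'i \<Rightarrow> real"
    using I by (auto simp: indicator_def prod_zero_iff)
  note [measurable] = X Y A
  have [measurable]: "finite I" by fact
  have "(LINT x|M. indicator {x. \<forall>i\<in>I. x i \<in> A i} (\<lambda>i. X i x) :: complex) = of_real (measure M {x \<in> space M. \<forall>i\<in>I. X i x \<in> A i})"
  proof -
    have "(LINT x|M. indicator {x. \<forall>i\<in>I. x i \<in> A i} (\<lambda>i. X i x) :: complex) = (LINT x|M. of_real (indicator {x\<in>space M. \<forall>i\<in>I. X i x \<in> A i} x))"
      by (intro Bochner_Integration.integral_cong) (auto simp: indicator_def)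
    thus ?thesis by (simp add: Int_def conj_commute cong: conj_cong)
  qed
  moreover have "(LINT x|N. indicator {x. \<forall>i\<in>I. x i \<in> A i} (\<lambda>i. Y i x) :: complex) = of_real (measure N {x \<in> space N. \<forall>i\<in>I. Y i x \<in> A i})"
  proof -
    have "(LINT x|N. indicator {x. \<forall>i\<in>I. x i \<in> A i} (\<lambda>i. Y i x) :: complex) = (LINT x|N. of_real (indicator {x\<in>space N. \<forall>i\<in>I. Y i x \<in> A i} x))"
      by (intro Bochner_Integration.integral_cong) (auto simp: indicator_def)
    thus ?thesis by (simp add: Int_def conj_commute cong: conj_cong)
  qed
  moreover have "(LINT x|M. (\<Prod>j\<in>I. indicator (A j) (X j x)) :: complex) = (LINT x|N. (\<Prod>j\<in>I. indicator (A j) (Y j x)))"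
    using joint_char_unique_aux[OF M N I X Y cf, where A=A and J=I and a="\<lambda>_. 0"] A by simp
  ultimately show ?thesis by (simp add: p)
qed

section \<open>Normal densities at the extreme-value scale\<close>

text \<open>Comparison with (1 - l/n)^n through |a^n - b^n| <= n |a - b|, valid for a and b in the
  unit ball.\<close>

lemma power_tendsto_exp:
  fixes p :: "nat \<Rightarrow> real"
  assumes lim: "(\<lambda>n. real n * (1 - p n)) \<longlonglongrightarrow> l" and p: "\<And>n. 0 \<le> p n" "\<And>n. p n \<le> 1"
  shows "(\<lambda>n. p n ^ n) \<longlonglongrightarrow> exp (- l)"
proof -
  have l: "l \<ge> 0" by (rule LIMSEQ_le_const[OF lim]) (use p in auto)
  have "(\<lambda>n. p n ^ n - (1 + (- l) / real n) ^ n) \<longlonglongrightarrow> 0"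
  proof (rule Lim_null_comparison)
    show "(\<lambda>n. \<bar>real n * (1 - p n) - l\<bar>) \<longlonglongrightarrow> 0"
      using tendsto_diff[OF lim tendsto_const[of l]] by (intro tendsto_rabs_zero) simp
    \<comment> \<open>For n > l the number 1 - l/n lies in [0, 1], as the power estimate
      requires.\<close>
    obtain m :: nat where m: "real m > l" using reals_Archimedean2 by blast
    show "\<forall>\<^sub>F n in sequentially. norm (p n ^ n - (1 + (- l) / real n) ^ n) \<le> \<bar>real n * (1 - p n) - l\<bar>"
      using eventually_gt_at_top[of m]
    proof eventually_elim
      case (elim n)
      hence n: "l < real n" "n > 0" using m by (simp_all add: order.strict_trans)
      have "norm (p n ^ n - (1 + (- l) / real n) ^ n) \<le> real n * norm (p n - (1 + (- l) / real n))"
        using p[of n] n l by (intro norm_power_diff) (auto simp: abs_le_iff field_simps)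
      also have "\<dots> = \<bar>real n * (p n - (1 + (- l) / real n))\<bar>" by (simp add: abs_mult)
      also have "real n * (p n - (1 + (- l) / real n)) = - (real n * (1 - p n) - l)"
        using n by (simp add: field_simps)
      finally show ?case by simp
    qed
  qed
  from tendsto_add[OF this tendsto_exp_limit_sequentially[of "-l"]] show ?thesis by simp
qed

text \<open>The exponent n - 1 appears once a coordinate has been singled out. Since p n tends to 1,
  one factor more or less does not change the limit.\<close>

lemma power_pred_tendsto_exp:
  fixes p :: "nat \<Rightarrow> real"
  assumes lim: "(\<lambda>n. real n * (1 - p n)) \<longlonglongrightarrow> l" and p: "\<And>n. 0 \<le> p n" "\<And>n. p n \<le> 1"
  shows "(\<lambda>n. p n ^ (n - 1)) \<longlonglongrightarrow> exp (- l)"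
proof -
  have "(\<lambda>n. real n * (1 - p n) * (1 / real n)) \<longlonglongrightarrow> l * 0"
    by (intro tendsto_mult lim lim_1_over_n)
  hence "(\<lambda>n. 1 - real n * (1 - p n) * (1 / real n)) \<longlonglongrightarrow> 1 - l * 0"
    by (intro tendsto_diff tendsto_const)
  moreover have "\<forall>\<^sub>F n in sequentially. 1 - real n * (1 - p n) * (1 / real n) = p n"
    using eventually_gt_at_top[of 0] by eventually_elim auto
  ultimately have p1: "p \<longlonglongrightarrow> 1" by (auto dest: Lim_transform_eventually)
  have "(\<lambda>n. p n ^ n / p n) \<longlonglongrightarrow> exp (- l) / 1"
    by (intro tendsto_divide power_tendsto_exp assms p1) auto
  moreover have "\<forall>\<^sub>F n in sequentially. p n ^ n / p n = p n ^ (n - 1)"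
    using order_tendstoD(1)[OF p1 zero_less_one] eventually_gt_at_top[of 0]
    by eventually_elim (auto simp: power_eq_if)
  ultimately show ?thesis by (auto dest: Lim_transform_eventually)
qed

section \<open>The normalising sequences c_n and d_n\<close>

lemma c_seq_pos: "n \<ge> 2 \<Longrightarrow> c_seq n > 0"
  by (simp add: c_seq_def)

lemma c_seq_sq: "n \<ge> 2 \<Longrightarrow> (c_seq n)\<^sup>2 = 2 * ln (real n)"
  by (simp add: c_seq_def)

lemma c_seq_at_top: "filterlim c_seq at_top sequentially"
  unfolding c_seq_def by real_asymp

lemma c_minus_d_eq: "c_seq n - d_seq n = (ln (ln (real n)) + ln (4 * pi)) / (2 * sqrt (2 * ln (real n)))"
  by (simp add: c_seq_def d_seq_def)

lemma c_minus_d_tendsto: "(\<lambda>n. c_seq n - d_seq n) \<longlonglongrightarrow> 0"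
  unfolding c_minus_d_eq by real_asymp

lemma d_over_c_tendsto: "(\<lambda>n. d_seq n / c_seq n) \<longlonglongrightarrow> 1"
proof -
  have "(\<lambda>n. 1 - (c_seq n - d_seq n) / c_seq n) \<longlonglongrightarrow> 1 - 0"
    by (intro tendsto_diff tendsto_const real_tendsto_divide_at_top[OF c_minus_d_tendsto] c_seq_at_top)
  moreover have "\<forall>\<^sub>F n in sequentially. 1 - (c_seq n - d_seq n) / c_seq n = d_seq n / c_seq n"
    using eventually_ge_at_top[of 2] 
  proof eventually_elim
    case (elim n)
    thus ?case using c_seq_pos[of n] by (simp add: diff_divide_distrib)
  qed
  ultimately show ?thesis by (auto dest: Lim_transform_eventually)
qed

text \<open>The upper bound 1 controls negative y and the lower bound 1/2 positive y in
  \<open>rescaled_density_le\<close>; any fixed lower bound in (0, 1) would serve.\<close>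

lemma d_over_c_bounds: "\<forall>\<^sub>F n in sequentially. 1/2 \<le> d_seq n / c_seq n \<and> d_seq n / c_seq n \<le> 1"
proof -
  have "\<forall>\<^sub>F n in sequentially. 1/2 < d_seq n / c_seq n"
    using order_tendstoD(1)[OF d_over_c_tendsto, of "1/2"] by simp
  moreover have "\<forall>\<^sub>F n in sequentially. ln (ln (real n)) + ln (4 * pi) \<ge> 0"
    by real_asymp
  ultimately show ?thesis using eventually_ge_at_top[of 2]
  proof eventually_elim
    case (elim n)
    hence "c_seq n - d_seq n \<ge> 0" unfolding c_minus_d_eq by simp
    thus ?case using elim c_seq_pos[of n] by simp
  qed
qed

text \<open>n times the density of c_n (X - d_n) for a standard normal X, that is, the intensity of
  the point process of all n rescaled coordinates. Its limit is the Poisson intensity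
  e^{-y}.\<close>

definition rescaled_density :: "nat \<Rightarrow> real \<Rightarrow> real" where
  "rescaled_density n y = real n * std_normal_density (d_seq n + y / c_seq n) / c_seq n"

lemma rescaled_density_measurable [measurable]: "rescaled_density n \<in> borel_measurable borel"
  unfolding rescaled_density_def by measurable

text \<open>The correction term of d_n is made for this identity: it gives sqrt (2 pi) c_n = exp
  (c_n (c_n - d_n)), so the prefactor of the normal density cancels exactly and a pure exponential
  is left, whose exponent tends to -y.\<close>

lemma rescaled_density_eq:
  assumes n: "n \<ge> 2"
  shows "rescaled_density n y =
    exp (- (c_seq n - d_seq n)\<^sup>2 / 2 - d_seq n / c_seq n * y - y\<^sup>2 / (2 * (c_seq n)\<^sup>2))"
proof -
  define c where "c = c_seq n"
  define \<delta> where "\<delta> = c_seq n - d_seq n"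
  have c: "c > 0" "c\<^sup>2 = 2 * ln (real n)" using c_seq_pos[OF n] c_seq_sq[OF n] by (auto simp: c_def)
  have d: "d_seq n = c - \<delta>" by (simp add: c_def \<delta>_def)
  have cd: "c * \<delta> = (ln (ln (real n)) + ln (4 * pi)) / 2"
    using c(1) by (simp add: \<delta>_def d_seq_def c_def c_seq_def field_simps)
  have "(sqrt (2 * pi) * c)\<^sup>2 = 4 * pi * ln (real n)"
    using c by (simp add: power_mult_distrib)
  also have "\<dots> = exp (2 * (c * \<delta>))"
  proof -
    have "2 * (c * \<delta>) = ln (ln (real n)) + ln (4 * pi)" using cd by simp
    thus ?thesis using n by (simp add: exp_add)
  qed
  also have "\<dots> = (exp (c * \<delta>))\<^sup>2" by (simp add: exp_double)
  finally have e: "sqrt (2 * pi) * c = exp (c * \<delta>)"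
    using c by (intro power2_eq_imp_eq[of _ "exp (c * \<delta>)"]) auto
  have sq: "(d_seq n + y / c)\<^sup>2 / 2 = ln (real n) - c * \<delta> + \<delta>\<^sup>2 / 2 + d_seq n / c * y + y\<^sup>2 / (2 * c\<^sup>2)"
  proof -
    have "(d_seq n + y / c)\<^sup>2 / 2 = (d_seq n)\<^sup>2 / 2 + d_seq n / c * y + y\<^sup>2 / (2 * c\<^sup>2)"
      using c(1) by (simp add: power2_eq_square field_simps)
    also have "(d_seq n)\<^sup>2 / 2 = c\<^sup>2 / 2 - c * \<delta> + \<delta>\<^sup>2 / 2"
      unfolding d by (simp add: power2_eq_square field_simps)
    finally show ?thesis by (simp add: c(2))
  qed
  have "rescaled_density n y = real n * exp (- ((d_seq n + y / c)\<^sup>2 / 2)) / (sqrt (2 * pi) * c)"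
    by (simp add: rescaled_density_def std_normal_density_def c_def)
  also have "\<dots> = exp (ln (real n) - (d_seq n + y / c)\<^sup>2 / 2 - c * \<delta>)"
    unfolding e exp_diff using n by (simp add: exp_minus field_simps)
  also have "\<dots> = exp (- \<delta>\<^sup>2 / 2 - d_seq n / c * y - y\<^sup>2 / (2 * c\<^sup>2))"
    unfolding sq by (simp add: algebra_simps)
  finally show ?thesis by (simp add: c_def \<delta>_def)
qed

lemma rescaled_density_nonneg: "rescaled_density n y \<ge> 0"
  unfolding rescaled_density_def c_seq_def
  by (cases n) (auto intro!: divide_nonneg_nonneg mult_nonneg_nonneg)

lemma rescaled_density_tendsto: "(\<lambda>n. rescaled_density n y) \<longlonglongrightarrow> exp (- y)"
proof -
  have ic: "(\<lambda>n. y\<^sup>2 / (2 * (c_seq n)\<^sup>2)) \<longlonglongrightarrow> 0"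
    unfolding c_seq_def by real_asymp
  have "(\<lambda>n. exp (- (c_seq n - d_seq n)\<^sup>2 / 2 - d_seq n / c_seq n * y - y\<^sup>2 / (2 * (c_seq n)\<^sup>2)))
     \<longlonglongrightarrow> exp (- 0\<^sup>2 / 2 - 1 * y - 0)"
    by (intro tendsto_intros c_minus_d_tendsto d_over_c_tendsto ic) auto
  moreover have "\<forall>\<^sub>F n in sequentially. exp (- (c_seq n - d_seq n)\<^sup>2 / 2 - d_seq n / c_seq n * y - y\<^sup>2 / (2 * (c_seq n)\<^sup>2))
     = rescaled_density n y"
    using eventually_ge_at_top[of 2] by eventually_elim (simp add: rescaled_density_eq)
  ultimately show ?thesis by (auto dest: Lim_transform_eventually)
qed

text \<open>Dropping the two squares leaves exp (- (d_n/c_n) y) with d_n/c_n between 1/2 and 1, and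
  the two summands cover the two signs of y. The bound serves twice: it is integrable on every (z,
  infinity), and after multiplication by e^{2y} it is integrable at minus infinity.\<close>

lemma rescaled_density_le: "\<forall>\<^sub>F n in sequentially. \<forall>y. rescaled_density n y \<le> exp (- y) + exp (- (y / 2))"
  using d_over_c_bounds eventually_ge_at_top[of 2]
proof eventually_elim
  case (elim n)
  show ?case
  proof
    fix y
    have "rescaled_density n y \<le> exp (- (d_seq n / c_seq n * y))"
    proof -
      have "0 \<le> (c_seq n - d_seq n)\<^sup>2 / 2" "0 \<le> y\<^sup>2 / (2 * (c_seq n)\<^sup>2)" by simp_all
      thus ?thesis using elim by (simp only: rescaled_density_eq exp_le_cancel_iff)
    qed
    also have "\<dots> \<le> exp (- y) + exp (- (y / 2))"
    proof (cases "y \<ge> 0")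
      case True
      hence "1/2 * y \<le> d_seq n / c_seq n * y" using elim by (intro mult_right_mono) auto
      hence "exp (- (d_seq n / c_seq n * y)) \<le> exp (- (y/2))" by simp
      thus ?thesis using exp_ge_zero[of "-y"] by linarith
    next
      case False
      hence "1 * y \<le> d_seq n / c_seq n * y" using elim by (intro mult_right_mono_neg) auto
      hence "exp (- (d_seq n / c_seq n * y)) \<le> exp (- y)" by simp
      thus ?thesis using exp_ge_zero[of "-(y/2)"] by linarith
    qed
    finally show "rescaled_density n y \<le> exp (- y) + exp (- (y / 2))" .
  qed
qed

lemma has_bochner_integral_exp_Ioi:
  assumes l: "(l::real) > 0"
  shows "has_bochner_integral lborel (\<lambda>y. indicator {z<..} y * exp (- (l * y))) (exp (- (l * z)) / l)"
proof -
  have "(\<integral>\<^sup>+y. ennreal (exp (- (l * y))) * indicator {z..} y \<partial>lborel) = ennreal (0 - (- exp (- (l * z)) / l))"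
  proof (rule nn_integral_FTC_atLeast)
    show "((\<lambda>y. - exp (- (l * y)) / l) \<longlongrightarrow> 0) at_top"
      using l by real_asymp
    show "((\<lambda>y. - exp (- (l * y)) / l) has_real_derivative exp (- (l * x))) (at x)" for x
      using l by (auto intro!: derivative_eq_intros)
  qed auto
  moreover have "(\<integral>\<^sup>+y. ennreal (exp (- (l * y))) * indicator {z..} y \<partial>lborel) =
      (\<integral>\<^sup>+y. ennreal (indicator {z<..} y * exp (- (l * y))) \<partial>lborel)"
    using AE_lborel_singleton[of z] by (intro nn_integral_cong_AE) (auto simp: indicator_def)
  ultimately show ?thesis
    using l by (intro has_bochner_integral_nn_integral) auto
qed

lemma has_bochner_integral_exp_Iio:
  assumes l: "(l::real) > 0"
  shows "has_bochner_integral lborel (\<lambda>y. indicator {..<z} y * exp (l * y)) (exp (l * z) / l)"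
proof -
  have "has_bochner_integral lborel (\<lambda>y. indicator {-z<..} y * exp (- (l * y))) (exp (l * z) / l)"
    using has_bochner_integral_exp_Ioi[OF l, of "-z"] by simp
  also have "(\<lambda>y. indicator {-z<..} y * exp (- (l * y))) = (\<lambda>y. indicator {..<z} (0 + (-1) * y) * exp (l * (0 + (-1) * y)) :: real)"
    by (auto simp: indicator_def fun_eq_iff)
  finally show ?thesis
    by (subst lborel_has_bochner_integral_real_affine_iff[where c="-1" and t=0]) simp_all
qed

text \<open>In use, \<open>f n y\<close> is either the constant 1 or the probability that all other
  coordinates are low enough when the singled-out one sits at y.\<close>

lemma rescaled_density_convergence:
  fixes f :: "nat \<Rightarrow> real \<Rightarrow> real"
  assumes [measurable]: "\<And>n. f n \<in> borel_measurable borel" "g \<in> borel_measurable borel"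
    and f: "\<And>n y. 0 \<le> f n y" "\<And>n y. f n y \<le> 1" and lim: "\<And>y. (\<lambda>n. f n y) \<longlonglongrightarrow> g y"
  shows "(\<lambda>n. LINT y|lborel. indicator {z<..} y * f n y * rescaled_density n y) \<longlonglongrightarrow>
           (LINT y|lborel. indicator {z<..} y * g y * exp (- y))"
proof -
  obtain n0 where n0: "\<And>n y. n \<ge> n0 \<Longrightarrow> rescaled_density n y \<le> exp (- y) + exp (- (y / 2))"
    using rescaled_density_le unfolding eventually_sequentially by blast
  show ?thesis
  \<comment> \<open>The dominating bound holds from \<open>n0\<close> on, so the sequence is shifted
    first.\<close>
  proof (rule LIMSEQ_offset[of _ n0], rule integral_dominated_convergence)
    show "integrable lborel (\<lambda>y. indicator {z<..} y * exp (- (1 * y)) + indicator {z<..} y * exp (- (1/2 * y)) :: real)"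
      using has_bochner_integral_exp_Ioi[of 1 z] has_bochner_integral_exp_Ioi[of "1/2" z]
      by (intro Bochner_Integration.integrable_add) (auto simp: has_bochner_integral_iff)
    show "AE y in lborel. norm (indicator {z<..} y * f (n + n0) y * rescaled_density (n + n0) y) \<le>
       indicator {z<..} y * exp (- (1 * y)) + indicator {z<..} y * exp (- (1/2 * y))" for n
    proof (intro AE_I2)
      fix y
      have "f (n + n0) y * rescaled_density (n + n0) y \<le> 1 * (exp (- y) + exp (- (y / 2)))"
        using f n0[of "n + n0" y] by (intro mult_mono) (auto simp: rescaled_density_nonneg)
      thus "norm (indicator {z<..} y * f (n + n0) y * rescaled_density (n + n0) y) \<le>
       indicator {z<..} y * exp (- (1 * y)) + indicator {z<..} y * exp (- (1/2 * y))"
        using f rescaled_density_nonneg by (auto simp: indicator_def)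
    qed
    show "AE y in lborel. (\<lambda>n. indicator {z<..} y * f (n + n0) y * rescaled_density (n + n0) y)
        \<longlonglongrightarrow> indicator {z<..} y * g y * exp (- y)"
      by (intro AE_I2 tendsto_intros LIMSEQ_ignore_initial_segment[OF lim] LIMSEQ_ignore_initial_segment[OF rescaled_density_tendsto])
  qed measurable
qed

section \<open>Normal tails and the limiting distribution function\<close>

interpretation std_normal: real_distribution std_normal_distribution
  by (rule real_dist_normal_dist)

abbreviation gauss_cdf :: "real \<Rightarrow> real" where
  "gauss_cdf \<equiv> cdf std_normal_distribution"

lemma nn_integral_std_normal_rescale:
  assumes [measurable]: "f \<in> borel_measurable borel" and n: "n \<ge> 2"
  shows "of_nat n * (\<integral>\<^sup>+x. f x \<partial>std_normal_distribution) =
     (\<integral>\<^sup>+y. f (d_seq n + y / c_seq n) * ennreal (rescaled_density n y) \<partial>lborel)"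
proof -
  have "(\<integral>\<^sup>+x. f x \<partial>std_normal_distribution) = (\<integral>\<^sup>+x. ennreal (std_normal_density x) * f x \<partial>lborel)"
    by (subst nn_integral_density) auto
  also have "\<dots> = ennreal (1 / c_seq n) * (\<integral>\<^sup>+y. ennreal (std_normal_density (d_seq n + (1 / c_seq n) * y)) * f (d_seq n + (1 / c_seq n) * y) \<partial>lborel)"
    using c_seq_pos[OF n] by (subst nn_integral_real_affine[of _ "1 / c_seq n" "d_seq n"]) auto
  finally have "of_nat n * (\<integral>\<^sup>+x. f x \<partial>std_normal_distribution) =
    (\<integral>\<^sup>+y. of_nat n * (ennreal (1 / c_seq n) * (ennreal (std_normal_density (d_seq n + (1 / c_seq n) * y)) * f (d_seq n + (1 / c_seq n) * y))) \<partial>lborel)"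
    by (simp add: nn_integral_cmult)
  also have "\<dots> = (\<integral>\<^sup>+y. f (d_seq n + y / c_seq n) * ennreal (rescaled_density n y) \<partial>lborel)"
  proof (rule nn_integral_cong)
    fix y
    have "ennreal (rescaled_density n y) =
        ennreal (real n * ((1 / c_seq n) * std_normal_density (d_seq n + (1 / c_seq n) * y)))"
      by (simp add: rescaled_density_def)
    also have "\<dots> = of_nat n * (ennreal (1 / c_seq n) * ennreal (std_normal_density (d_seq n + (1 / c_seq n) * y)))"
      using c_seq_pos[OF n] by (simp only: ennreal_mult' of_nat_0_le_iff ennreal_of_nat_eq_real_of_nat
          zero_le_divide_1_iff less_imp_le)
    finally show "of_nat n * (ennreal (1 / c_seq n) * (ennreal (std_normal_density (d_seq n + (1 / c_seq n) * y)) * f (d_seq n + (1 / c_seq n) * y)))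
        = f (d_seq n + y / c_seq n) * ennreal (rescaled_density n y)"
      by (simp add: ac_simps)
  qed
  finally show ?thesis .
qed

lemma integral_std_normal_rescale:
  assumes [measurable]: "f \<in> borel_measurable borel" and f: "\<And>x. f x \<ge> 0" and n: "n \<ge> 2"
  shows "real n * (LINT x|std_normal_distribution. f x) =
     (LINT y|lborel. f (d_seq n + y / c_seq n) * rescaled_density n y)"
proof -
  have "real n * (LINT x|std_normal_distribution. f x) = enn2real (of_nat n * (\<integral>\<^sup>+x. f x \<partial>std_normal_distribution))"
    using f by (subst integral_eq_nn_integral) (auto simp: enn2real_mult)
  also have "\<dots> = (LINT y|lborel. f (d_seq n + y / c_seq n) * rescaled_density n y)"
    using f n rescaled_density_nonneg
    by (subst nn_integral_std_normal_rescale; (subst integral_eq_nn_integral)?) (auto simp: ennreal_mult)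
  finally show ?thesis .
qed

text \<open>The expected number of rescaled coordinates above y, obtained from the weight
  \<open>f = 1\<close>.\<close>

lemma gauss_tail_tendsto: "(\<lambda>n. real n * (1 - gauss_cdf (d_seq n + y / c_seq n))) \<longlonglongrightarrow> exp (- y)"
proof -
  have "(\<lambda>n. LINT x|lborel. indicator {y<..} x * 1 * rescaled_density n x) \<longlonglongrightarrow> (LINT x|lborel. indicator {y<..} x * 1 * exp (- x))"
    by (rule rescaled_density_convergence) auto
  also have "(LINT x|lborel. indicator {y<..} x * 1 * exp (- x)) = exp (- y)"
    using has_bochner_integral_exp_Ioi[of 1 y] by (simp add: has_bochner_integral_iff)
  finally have "(\<lambda>n. LINT x|lborel. indicator {y<..} x * 1 * rescaled_density n x) \<longlonglongrightarrow> exp (- y)" .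
  moreover have "\<forall>\<^sub>F n in sequentially. (LINT x|lborel. indicator {y<..} x * 1 * rescaled_density n x) = real n * (1 - gauss_cdf (d_seq n + y / c_seq n))"
    using eventually_ge_at_top[of 2]
  proof eventually_elim
    case (elim n)
    have "1 - gauss_cdf (d_seq n + y / c_seq n) = measure std_normal_distribution {d_seq n + y / c_seq n<..}"
      using std_normal.prob_compl[of "{..d_seq n + y / c_seq n}"] by (simp add: cdf_def Compl_eq_Diff_UNIV[symmetric] Compl_atMost)
    also have "\<dots> = (LINT x|std_normal_distribution. indicator {d_seq n + y / c_seq n<..} x)" by simp
    finally have "real n * (1 - gauss_cdf (d_seq n + y / c_seq n)) = (LINT x|lborel. indicator {d_seq n + y / c_seq n<..} (d_seq n + x / c_seq n) * rescaled_density n x)"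
      using elim by (simp only:) (rule integral_std_normal_rescale, auto)
    also have "\<dots> = (LINT x|lborel. indicator {y<..} x * 1 * rescaled_density n x)"
      using c_seq_pos[OF elim] by (intro Bochner_Integration.integral_cong) (auto simp: indicator_def divide_less_cancel)
    finally show ?case ..
  qed
  ultimately show ?thesis by (auto dest: Lim_transform_eventually)
qed

lemma gauss_cdf_power_tendsto: "(\<lambda>n. gauss_cdf (d_seq n + y / c_seq n) ^ n) \<longlonglongrightarrow> exp (- exp (- y))"
  by (rule power_tendsto_exp; intro gauss_tail_tendsto std_normal.cdf_nonneg std_normal.cdf_bounded_prob)

lemma gauss_cdf_power_pred_tendsto: "(\<lambda>n. gauss_cdf (d_seq n + y / c_seq n) ^ (n - 1)) \<longlonglongrightarrow> exp (- exp (- y))"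
  by (rule power_pred_tendsto_exp; intro gauss_tail_tendsto std_normal.cdf_nonneg std_normal.cdf_bounded_prob)

text \<open>Distribution function of eta_1 + eta_2, split by the larger point. If eta_1 <= z/2, the
  sum is at most z. Otherwise there is a point at y > z/2, with intensity e^{-y}, and no other point
  may lie above z - y, which has probability exp (- e^{-(z-y)}).\<close>

definition limit_cdf :: "real \<Rightarrow> real" where
  "limit_cdf z = exp (- exp (- (z / 2))) + (LINT y|lborel. indicator {z/2<..} y * exp (- exp (- (z - y))) * exp (- y))"

lemma gauss_cdf_measurable [measurable]: "gauss_cdf \<in> borel_measurable borel"
  by (intro borel_measurable_mono monoI std_normal.cdf_nondecreasing)

text \<open>The left side is the form that \<open>measure_PiM_pair_sums_le\<close> takes after
  rescaling: no coordinate above z/2, or one at y and the other n - 1 at most z - y.\<close>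

lemma top_two_sum_tendsto:
  "(\<lambda>n. gauss_cdf (d_seq n + (z/2) / c_seq n) ^ n +
     (LINT y|lborel. indicator {z/2<..} y * gauss_cdf (d_seq n + (z - y) / c_seq n) ^ (n - 1) * rescaled_density n y))
   \<longlonglongrightarrow> limit_cdf z"
  unfolding limit_cdf_def
proof (rule tendsto_add[OF gauss_cdf_power_tendsto], rule rescaled_density_convergence)
  show "(\<lambda>n. gauss_cdf (d_seq n + (z - y) / c_seq n) ^ (n - 1)) \<longlonglongrightarrow> exp (- exp (- (z - y)))" for y
    by (rule gauss_cdf_power_pred_tendsto)
qed (auto simp: std_normal.cdf_nonneg std_normal.cdf_bounded_prob intro!: power_le_one)

text \<open>Multiplying the bound of \<open>rescaled_density_le\<close> by e^{2y} leaves e^y +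
  e^{3y/2}, integrable at minus infinity. The truncation at K removes the other end, where the
  weight outgrows the intensity.\<close>

lemma truncated_exp_moment_bounded:
  "\<exists>B. \<forall>\<^sub>F n in sequentially. real n * (LINT x|std_normal_distribution.
      indicator {..<d_seq n + K / c_seq n} x * exp (2 * (c_seq n * (x - d_seq n)))) \<le> B"
proof (rule exI, use rescaled_density_le eventually_ge_at_top[of 2] in eventually_elim)
  case (elim n)
  have i: "integrable lborel (\<lambda>y. indicator {..<K} y * exp (1 * y) + indicator {..<K} y * exp (3/2 * y) :: real)"
    using has_bochner_integral_exp_Iio[of 1 K] has_bochner_integral_exp_Iio[of "3/2" K]
    by (intro Bochner_Integration.integrable_add) (auto simp: has_bochner_integral_iff)
  have "real n * (LINT x|std_normal_distribution. indicator {..<d_seq n + K / c_seq n} x * exp (2 * (c_seq n * (x - d_seq n)))) =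
    (LINT y|lborel. indicator {..<d_seq n + K / c_seq n} (d_seq n + y / c_seq n) * exp (2 * (c_seq n * ((d_seq n + y / c_seq n) - d_seq n))) * rescaled_density n y)"
    using elim by (intro integral_std_normal_rescale) auto
  also have "\<dots> \<le> (LINT y|lborel. indicator {..<K} y * exp (1 * y) + indicator {..<K} y * exp (3/2 * y))"
  proof (rule Bochner_Integration.integral_mono'[OF i])
    fix y
    have "exp (2 * y) * rescaled_density n y \<le> exp (2 * y) * (exp (- y) + exp (- (y / 2)))"
      using elim by (intro mult_left_mono) auto
    also have "\<dots> = exp (1 * y) + exp (3/2 * y)" by (simp add: distrib_left exp_add[symmetric])
    finally show "indicator {..<d_seq n + K / c_seq n} (d_seq n + y / c_seq n) * exp (2 * (c_seq n * ((d_seq n + y / c_seq n) - d_seq n))) * rescaled_density n y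
      \<le> indicator {..<K} y * exp (1 * y) + indicator {..<K} y * exp (3/2 * y)"
      using c_seq_pos[of n] elim by (auto simp: indicator_def divide_less_cancel)
  qed (auto simp: indicator_def)
  finally show "real n * (LINT x|std_normal_distribution.
      indicator {..<d_seq n + K / c_seq n} x * exp (2 * (c_seq n * (x - d_seq n)))) \<le> (LINT y|lborel. indicator {..<K} y * exp (1 * y) + indicator {..<K} y * exp (3/2 * y))" .
qed

section \<open>Pair sums in a product space\<close>

text \<open>Fubini with coordinate i outermost: at value t the other coordinates must all be at most
  w - t, and by independence this has a power of the distribution function as its
  probability.\<close>

lemma measure_PiM_exceed:
  fixes \<nu> :: "real measure"
  assumes \<nu>: "real_distribution \<nu>" and I: "finite I" "i \<in> I"
  shows "measure (PiM I (\<lambda>_. \<nu>)) {x \<in> space (PiM I (\<lambda>_. \<nu>)). w/2 < x i \<and> (\<forall>j\<in>I - {i}. x i + x j \<le> w)} =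
    (LINT t|\<nu>. indicator {w/2<..} t * cdf \<nu> (w - t) ^ (card I - 1))"
proof -
  interpret \<nu>: real_distribution \<nu> by fact
  interpret P: product_sigma_finite "\<lambda>_. \<nu>" by standard
  define J where "J = I - {i}"
  have J: "finite J" "i \<notin> J" "I = insert i J" using I by (auto simp: J_def)
  have cJ: "card I - 1 = card J" using I by (simp add: J_def)
  define S where "S = {x \<in> space (PiM I (\<lambda>_. \<nu>)). w/2 < x i \<and> (\<forall>j\<in>J. x i + x j \<le> w)}"
  have comp: "(\<lambda>x. x k) \<in> borel_measurable (PiM I (\<lambda>_. \<nu>))" if "k \<in> I" for k
    using measurable_component_singleton[OF that, of "\<lambda>_. \<nu>"]
    unfolding measurable_cong_sets[OF refl \<nu>.events_eq_borel] .
  have Sm: "S \<in> sets (PiM I (\<lambda>_. \<nu>))"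
    unfolding S_def using comp I J(1) by (intro sets.sets_Collect sets.sets_Collect_finite_All borel_measurable_less borel_measurable_le borel_measurable_add borel_measurable_const) (auto simp: J_def)
  have cm: "cdf \<nu> \<in> borel_measurable borel"
    by (intro borel_measurable_mono monoI \<nu>.cdf_nondecreasing)
  have "emeasure (PiM I (\<lambda>_. \<nu>)) S = (\<integral>\<^sup>+x. indicator S x \<partial>PiM (insert i J) (\<lambda>_. \<nu>))"
    using Sm J by simp
  also have "\<dots> = (\<integral>\<^sup>+t. (\<integral>\<^sup>+x. indicator S (x(i := t)) \<partial>PiM J (\<lambda>_. \<nu>)) \<partial>\<nu>)"
    using Sm J by (intro P.product_nn_integral_insert_rev) auto
  also have "\<dots> = (\<integral>\<^sup>+t. ennreal (indicator {w/2<..} t * cdf \<nu> (w - t) ^ card J) \<partial>\<nu>)"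
  \<comment> \<open>For fixed t the section of \<open>S\<close> is a box in the remaining
    coordinates, or empty when t <= w/2.\<close>
  proof (rule nn_integral_cong)
    fix t
    have "(\<integral>\<^sup>+x. indicator S (x(i := t)) \<partial>PiM J (\<lambda>_. \<nu>)) =
      (\<integral>\<^sup>+x. indicator {w/2<..} t * indicator (PiE J (\<lambda>_. {..w - t})) x \<partial>PiM J (\<lambda>_. \<nu>))"
      using J by (intro nn_integral_cong)
        (auto simp: indicator_def S_def space_PiM PiE_iff extensional_def algebra_simps split: if_splits)
    also have "\<dots> = indicator {w/2<..} t * emeasure (PiM J (\<lambda>_. \<nu>)) (PiE J (\<lambda>_. {..w - t}))"
      using J by (intro nn_integral_cmult_indicator) (auto intro!: sets_PiM_I_finite)
    also have "emeasure (PiM J (\<lambda>_. \<nu>)) (PiE J (\<lambda>_. {..w - t})) = ennreal (cdf \<nu> (w - t)) ^ card J"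
      using J by (subst P.emeasure_PiM) (auto simp: \<nu>.emeasure_eq_measure cdf_def)
    also have "indicator {w/2<..} t * ennreal (cdf \<nu> (w - t)) ^ card J = ennreal (indicator {w/2<..} t * cdf \<nu> (w - t) ^ card J)"
      by (simp add: ennreal_power \<nu>.cdf_nonneg indicator_def)
    finally show "(\<integral>\<^sup>+x. indicator S (x(i := t)) \<partial>PiM J (\<lambda>_. \<nu>)) = ennreal (indicator {w/2<..} t * cdf \<nu> (w - t) ^ card J)" .
  qed
  finally have e: "emeasure (PiM I (\<lambda>_. \<nu>)) S = (\<integral>\<^sup>+t. ennreal (indicator {w/2<..} t * cdf \<nu> (w - t) ^ card J) \<partial>\<nu>)" .
  have "(LINT t|\<nu>. indicator {w/2<..} t * cdf \<nu> (w - t) ^ card J) = measure (PiM I (\<lambda>_. \<nu>)) S"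
    using cm by (subst integral_eq_nn_integral) (auto simp: measure_def e \<nu>.cdf_nonneg)
  thus ?thesis unfolding cJ S_def J_def by simp
qed

text \<open>Either no coordinate exceeds \<open>w/2\<close>, or exactly one does.\<close>
lemma measure_PiM_pair_sums_le:
  fixes \<nu> :: "real measure"
  assumes \<nu>: "real_distribution \<nu>" and I: "finite I"
  shows "measure (PiM I (\<lambda>_. \<nu>)) {x \<in> space (PiM I (\<lambda>_. \<nu>)). \<forall>i\<in>I. \<forall>j\<in>I. i \<noteq> j \<longrightarrow> x i + x j \<le> w} =
    cdf \<nu> (w/2) ^ card I + real (card I) * (LINT t|\<nu>. indicator {w/2<..} t * cdf \<nu> (w - t) ^ (card I - 1))"
proof -
  interpret \<nu>: real_distribution \<nu> by fact
  interpret P: product_sigma_finite "\<lambda>_. \<nu>" by standard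
  interpret PI: prob_space "PiM I (\<lambda>_. \<nu>)" by (intro prob_space_PiM \<nu>.prob_space_axioms)
  define T where "T = PiE I (\<lambda>_. {..w/2})"
  define S where "S i = {x \<in> space (PiM I (\<lambda>_. \<nu>)). w/2 < x i \<and> (\<forall>j\<in>I - {i}. x i + x j \<le> w)}" for i
  have comp: "(\<lambda>x. x k) \<in> borel_measurable (PiM I (\<lambda>_. \<nu>))" if "k \<in> I" for k
    using measurable_component_singleton[OF that, of "\<lambda>_. \<nu>"]
    unfolding measurable_cong_sets[OF refl \<nu>.events_eq_borel] .
  have Sm: "S i \<in> sets (PiM I (\<lambda>_. \<nu>))" if "i \<in> I" for i
    unfolding S_def using comp I that by (intro sets.sets_Collect sets.sets_Collect_finite_All borel_measurable_less borel_measurable_le borel_measurable_add borel_measurable_const) auto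
  have Tm: "T \<in> sets (PiM I (\<lambda>_. \<nu>))"
    unfolding T_def using I by (intro sets_PiM_I_finite) auto
  have "{x \<in> space (PiM I (\<lambda>_. \<nu>)). \<forall>i\<in>I. \<forall>j\<in>I. i \<noteq> j \<longrightarrow> x i + x j \<le> w} = T \<union> (\<Union>i\<in>I. S i)"
  proof (intro set_eqI iffI)
    fix x assume x: "x \<in> {x \<in> space (PiM I (\<lambda>_. \<nu>)). \<forall>i\<in>I. \<forall>j\<in>I. i \<noteq> j \<longrightarrow> x i + x j \<le> w}"
    show "x \<in> T \<union> (\<Union>i\<in>I. S i)"
    proof (cases "\<forall>i\<in>I. x i \<le> w/2")
      case True thus ?thesis using x by (auto simp: T_def space_PiM PiE_iff)
    next
      case False
      then obtain i where "i \<in> I" "w/2 < x i" by force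
      hence "x \<in> S i" using x by (auto simp: S_def)
      thus ?thesis using \<open>i \<in> I\<close> by blast
    qed
  next
    fix x assume "x \<in> T \<union> (\<Union>i\<in>I. S i)"
    thus "x \<in> {x \<in> space (PiM I (\<lambda>_. \<nu>)). \<forall>i\<in>I. \<forall>j\<in>I. i \<noteq> j \<longrightarrow> x i + x j \<le> w}"
    proof
      assume T: "x \<in> T"
      have "x i + x j \<le> w" if "i \<in> I" "j \<in> I" for i j
      proof -
        have "x i \<le> w/2" "x j \<le> w/2" using T that by (auto simp: T_def)
        thus ?thesis by simp
      qed
      thus ?thesis using T by (auto simp: T_def space_PiM PiE_iff)
    next
      assume "x \<in> (\<Union>i\<in>I. S i)"
      then obtain k where k: "k \<in> I" "x \<in> S k" by auto
      hence le: "w/2 < x k" "x k + x j \<le> w" if "j \<in> I" "j \<noteq> k" for j using that by (auto simp: S_def)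
      have "x i + x j \<le> w" if "i \<in> I" "j \<in> I" "i \<noteq> j" for i j
      proof (cases "i = k \<or> j = k")
        case True
        thus ?thesis using le(2)[of i] le(2)[of j] that by (auto simp: add.commute)
      next
        case False
        \<comment> \<open>Coordinates other than k are at most w - x k < w/2.\<close>
        hence "x i \<le> w/2" "x j \<le> w/2" using le[of i] le[of j] that by (fastforce simp: field_simps)+
        thus ?thesis by simp
      qed
      thus ?thesis using k by (auto simp: S_def)
    qed
  qed
  moreover have "measure (PiM I (\<lambda>_. \<nu>)) (T \<union> (\<Union>i\<in>I. S i)) = measure (PiM I (\<lambda>_. \<nu>)) T + measure (PiM I (\<lambda>_. \<nu>)) (\<Union>i\<in>I. S i)"
  proof (rule measure_Union)
    show "T \<inter> (\<Union>i\<in>I. S i) = {}"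
    proof -
      have False if "x \<in> T" "x \<in> S i" "i \<in> I" for x i
      proof -
        have "x i \<le> w/2" "w/2 < x i" using that PiE_mem[of x I "\<lambda>_. {..w/2}" i] by (auto simp: T_def S_def)
        thus False by simp
      qed
      thus ?thesis by blast
    qed
  qed (use Tm Sm I in \<open>auto simp: PI.emeasure_eq_measure\<close>)
  moreover have "measure (PiM I (\<lambda>_. \<nu>)) (\<Union>i\<in>I. S i) = (\<Sum>i\<in>I. measure (PiM I (\<lambda>_. \<nu>)) (S i))"
  proof (rule PI.finite_measure_finite_Union[OF I])
    show "disjoint_family_on S I"
      unfolding disjoint_family_on_def
    proof (intro ballI impI)
      fix i j assume ij: "i \<in> I" "j \<in> I" "i \<noteq> j"
      have False if "x \<in> S i" "x \<in> S j" for x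
      proof -
        have "w/2 < x i" "w/2 < x j" "x i + x j \<le> w" using that ij by (auto simp: S_def)
        thus False by simp
      qed
      thus "S i \<inter> S j = {}" by auto
    qed
  qed (use Sm in auto)
  moreover have "measure (PiM I (\<lambda>_. \<nu>)) T = cdf \<nu> (w/2) ^ card I"
  proof -
    have "emeasure (PiM I (\<lambda>_. \<nu>)) T = ennreal (cdf \<nu> (w/2)) ^ card I"
      unfolding T_def using I by (subst P.emeasure_PiM) (auto simp: \<nu>.emeasure_eq_measure cdf_def)
    thus ?thesis by (simp add: measure_def ennreal_power \<nu>.cdf_nonneg)
  qed
  moreover have "measure (PiM I (\<lambda>_. \<nu>)) (S i) = (LINT t|\<nu>. indicator {w/2<..} t * cdf \<nu> (w - t) ^ (card I - 1))" if "i \<in> I" for i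
    unfolding S_def by (rule measure_PiM_exceed[OF \<nu> I that])
  ultimately show ?thesis by simp
qed

section \<open>The limit law\<close>

text \<open>The substitution s = e^{-y}, that is, the passage from zeta_1 to eta_1 = - log zeta_1.
  The integrand on the left is the density e^{-s} of zeta_1 times the probability that zeta_2 is at
  least e^{-z}/s - s.\<close>

lemma nn_integral_exp_substitution:
  "(\<integral>\<^sup>+s. ennreal (indicator {0<..<exp (- (z/2))} s * exp (- (exp (- z) / s))) \<partial>lborel) =
   ennreal (LINT y|lborel. indicator {z/2<..} y * exp (- exp (- (z - y))) * exp (- y))"
proof -
  define h :: "real \<Rightarrow> real" where "h s = exp (- (exp (- z) / s))" for s
  have [measurable]: "h \<in> borel_measurable borel" unfolding h_def by measurable
  define S where "S = {z/2<..}"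
  have hg: "\<bar>- exp (- y)\<bar> * h (exp (- y)) = exp (- exp (- (z - y))) * exp (- y)" for y
    by (simp add: h_def exp_diff exp_minus field_simps)
  have img: "(\<lambda>y. exp (- y)) ` S = {0<..<exp (- (z/2))}"
  proof (intro set_eqI iffI)
    fix s assume "s \<in> {0<..<exp (- (z/2))}"
    hence "s > 0" "ln s < - (z/2)" using ln_less_cancel_iff[of s "exp (- (z/2))"] by auto
    thus "s \<in> (\<lambda>y. exp (- y)) ` S"
      by (intro image_eqI[of _ _ "- ln s"]) (auto simp: S_def)
  qed (auto simp: S_def)
  define b where "b = (LINT y|lborel. indicator {z/2<..} y * exp (- exp (- (z - y))) * exp (- y))"
  have i: "integrable lborel (\<lambda>y. indicator {z/2<..} y * exp (- exp (- (z - y))) * exp (- y) :: real)"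
  proof (rule Bochner_Integration.integrable_bound)
    show "integrable lborel (\<lambda>y. indicator {z/2<..} y * exp (- (1 * y)) :: real)"
      using has_bochner_integral_exp_Ioi[of 1 "z/2"] by (auto simp: has_bochner_integral_iff)
  qed (auto simp: indicator_def)
  \<comment> \<open>The change of variables speaks of Lebesgue measure, hence the passage through
    the completion.\<close>
  have i': "integrable lebesgue (\<lambda>y. indicator {z/2<..} y * exp (- exp (- (z - y))) * exp (- y) :: real)"
    using i by (subst integrable_completion) auto
  have b': "b = (LINT y|lebesgue. indicator {z/2<..} y * exp (- exp (- (z - y))) * exp (- y))"
    unfolding b_def by (subst integral_completion) auto
  have ai: "(\<lambda>y. \<bar>- exp (- y)\<bar> * h (exp (- y))) absolutely_integrable_on S"
    using i' unfolding set_integrable_def hg S_def by (simp add: mult.assoc)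
  moreover have "integral S (\<lambda>y. \<bar>- exp (- y)\<bar> * h (exp (- y))) = b"
    using set_lebesgue_integral_eq_integral(2)[OF ai]
    unfolding set_lebesgue_integral_def hg b' S_def by (simp add: mult.assoc)
  ultimately have "h absolutely_integrable_on ((\<lambda>y. exp (- y)) ` S) \<and> integral ((\<lambda>y. exp (- y)) ` S) h = b"
  proof (intro has_absolute_integral_change_of_variables_1'[THEN iffD1, OF _ _ _ conjI])
    show "((\<lambda>y. exp (- y)) has_real_derivative - exp (- y)) (at y within S)" for y
      by (auto intro!: derivative_eq_intros)
  qed (auto simp: S_def inj_on_def)
  hence hi: "h absolutely_integrable_on {0<..<exp (- (z/2))}" "integral {0<..<exp (- (z/2))} h = b"
    by (auto simp: img)
  have "(\<integral>\<^sup>+s. ennreal (indicator {0<..<exp (- (z/2))} s * h s) \<partial>lborel) =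
      (\<integral>\<^sup>+s. ennreal (indicator {0<..<exp (- (z/2))} s * h s) \<partial>lebesgue)"
    by (simp add: nn_integral_completion)
  also have "\<dots> = ennreal (LINT s|lebesgue. indicator {0<..<exp (- (z/2))} s * h s)"
    using hi(1) unfolding set_integrable_def by (intro nn_integral_eq_integral) (auto simp: h_def)
  also have "(LINT s|lebesgue. indicator {0<..<exp (- (z/2))} s * h s) = b"
    using set_lebesgue_integral_eq_integral(2)[OF hi(1)] hi(2) by (simp add: set_lebesgue_integral_def)
  finally show ?thesis by (simp add: h_def b_def)
qed

section \<open>The law of the first two exponential gaps\<close>

abbreviation exp_law :: "real measure" where
  "exp_law \<equiv> density lborel (\<lambda>x. ennreal (exponential_density 1 x))"

lemma emeasure_exp_law_atLeast: "emeasure exp_law {a..} = ennreal (exp (- max 0 a))"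
proof -
  have "emeasure exp_law {a..} = (\<integral>\<^sup>+x. ennreal (exponential_density 1 x) * indicator {a..} x \<partial>lborel)"
    by (subst emeasure_density) auto
  also have "\<dots> = (\<integral>\<^sup>+x. ennreal (indicator {max 0 a<..} x * exp (- (1 * x))) \<partial>lborel)"
    using AE_lborel_singleton[of 0] AE_lborel_singleton[of a]
    by (intro nn_integral_cong_AE) (auto simp: indicator_def exponential_density_def)
  also have "\<dots> = ennreal (LINT x|lborel. indicator {max 0 a<..} x * exp (- (1 * x)))"
    using has_bochner_integral_exp_Ioi[of 1 "max 0 a"]
    by (intro nn_integral_eq_integral) (auto simp: has_bochner_integral_iff)
  also have "(LINT x|lborel. indicator {max 0 a<..} x * exp (- (1 * x))) = exp (- max 0 a)"
    using has_bochner_integral_exp_Ioi[of 1 "max 0 a"] by (simp add: has_bochner_integral_iff)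
  finally show ?thesis .
qed

text \<open>For s, t > 0 the event reads t >= e^{-z}/s - s. When s > w = e^{-z/2} this is no
  restriction, and the mass exp (-w) of such s is the first term of \<open>limit_cdf\<close>. When s
  < w, the tail exp (- (e^{-z}/s - s)) cancels the density e^{-s} and leaves the integrand of
  \<open>nn_integral_exp_substitution\<close>.\<close>

lemma exp_law_pair:
  "emeasure (exp_law \<Otimes>\<^sub>M exp_law) {(s, t). - ln s + - ln (s + t) \<le> z} = ennreal (limit_cdf z)"
proof -
  interpret E: prob_space exp_law by (rule prob_space_exponential_density) simp
  define w where "w = exp (- (z/2))"
  have w: "w > 0" "w * w = exp (- z)" by (simp_all add: w_def mult_exp_exp)
  have setm: "{(s, t). - ln s + - ln (s + t) \<le> z} \<in> sets (exp_law \<Otimes>\<^sub>M exp_law)"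
  proof -
    have "{x \<in> space (borel \<Otimes>\<^sub>M borel). - ln (fst x) + - ln (fst x + snd x) \<le> z} \<in> sets (borel \<Otimes>\<^sub>M borel :: (real \<times> real) measure)"
      by measurable
    also have "sets (borel \<Otimes>\<^sub>M borel :: (real \<times> real) measure) = sets (exp_law \<Otimes>\<^sub>M exp_law)"
      by (intro sets_pair_measure_cong) auto
    also have "{x \<in> space (borel \<Otimes>\<^sub>M borel). - ln (fst x) + - ln (fst x + snd x) \<le> z} = {(s, t). - ln s + - ln (s + t) \<le> z}"
      by (auto simp: space_pair_measure)
    finally show ?thesis .
  qed
  have inner: "emeasure exp_law (Pair s -` {(s, t). - ln s + - ln (s + t) \<le> z}) = ennreal (exp (- max 0 (exp (- z) / s - s)))" if s: "s > 0" for s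
  proof -
    have iff: "- ln s - ln (s + t) \<le> z \<longleftrightarrow> exp (- z) / s - s \<le> t" if t: "t > 0" for t
    proof -
      have "- ln s - ln (s + t) \<le> z \<longleftrightarrow> - z \<le> ln (s * (s + t))"
        using s t by (auto simp: ln_mult)
      also have "\<dots> \<longleftrightarrow> exp (- z) \<le> s * (s + t)"
        using s t by (subst ln_ge_iff) auto
      also have "\<dots> \<longleftrightarrow> exp (- z) / s - s \<le> t"
        using s by (simp add: field_simps)
      finally show ?thesis .
    qed
    have m: "Pair s -` {(s, t). - ln s + - ln (s + t) \<le> z} \<in> sets exp_law"
      using sets_Pair1[OF setm] .
    \<comment> \<open>The equivalence \<open>iff\<close> is available for t > 0; the remaining t
      form a null set.\<close>
    have "AE t in exp_law. t > 0"
      using AE_lborel_singleton[of 0]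
      by (subst AE_density) (auto simp: exponential_density_def elim!: eventually_mono)
    hence "emeasure exp_law (Pair s -` {(s, t). - ln s + - ln (s + t) \<le> z}) = emeasure exp_law {exp (- z) / s - s..}"
      using m by (intro emeasure_eq_AE) (auto elim!: eventually_mono simp: iff)
    thus ?thesis by (simp add: emeasure_exp_law_atLeast)
  qed
  have "emeasure (exp_law \<Otimes>\<^sub>M exp_law) {(s, t). - ln s + - ln (s + t) \<le> z} =
      (\<integral>\<^sup>+s. emeasure exp_law (Pair s -` {(s, t). - ln s + - ln (s + t) \<le> z}) \<partial>exp_law)"
    by (rule E.emeasure_pair_measure_alt[OF setm])
  also have "\<dots> = (\<integral>\<^sup>+s. ennreal (exponential_density 1 s) * emeasure exp_law (Pair s -` {(s, t). - ln s + - ln (s + t) \<le> z}) \<partial>lborel)"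
    using E.measurable_emeasure_Pair[OF setm]
    by (subst nn_integral_density) auto
  also have "\<dots> = (\<integral>\<^sup>+s. ennreal (indicator {w<..} s * exp (- (1 * s))) + ennreal (indicator {0<..<w} s * exp (- (exp (- z) / s))) \<partial>lborel)"
  proof (rule nn_integral_cong_AE, use AE_lborel_singleton[of 0] AE_lborel_singleton[of w] in eventually_elim)
    case (elim s)
    show ?case
    proof (cases "s > 0")
      case True
      have "exp (- z) / s - s \<le> 0 \<longleftrightarrow> w * w \<le> s * s" using True by (simp add: w field_simps)
      also have "\<dots> \<longleftrightarrow> w < s" using True w(1) elim abs_le_square_iff[of w s] by (auto simp: power2_eq_square)
      finally show ?thesis using True elim w(1) unfolding inner[OF True]
        by (auto simp: exponential_density_def indicator_def max_def ennreal_mult[symmetric] mult_exp_exp)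
    next
      case False
      thus ?thesis using elim w(1) by (auto simp: exponential_density_def indicator_def)
    qed
  qed
  also have "\<dots> = (\<integral>\<^sup>+s. ennreal (indicator {w<..} s * exp (- (1 * s))) \<partial>lborel) + (\<integral>\<^sup>+s. ennreal (indicator {0<..<w} s * exp (- (exp (- z) / s))) \<partial>lborel)"
    by (rule nn_integral_add) auto
  also have "(\<integral>\<^sup>+s. ennreal (indicator {w<..} s * exp (- (1 * s))) \<partial>lborel) = ennreal (exp (- w))"
    using has_bochner_integral_exp_Ioi[of 1 w] by (subst nn_integral_eq_integral) (auto simp: has_bochner_integral_iff)
  also have "(\<integral>\<^sup>+s. ennreal (indicator {0<..<w} s * exp (- (exp (- z) / s))) \<partial>lborel) =
      ennreal (LINT y|lborel. indicator {z/2<..} y * exp (- exp (- (z - y))) * exp (- y))"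
    unfolding w_def by (rule nn_integral_exp_substitution)
  also have "ennreal (exp (- w)) + \<dots> = ennreal (limit_cdf z)"
    unfolding limit_cdf_def w_def
    by (subst ennreal_plus[symmetric]) (auto intro!: Bochner_Integration.integral_nonneg)
  finally show ?thesis .
qed

lemma (in prob_space) cdf_log_gamma_sum:
  assumes indep: "indep_vars (\<lambda>_. borel) \<zeta> {1::nat..}"
    and exp: "\<And>k. k \<ge> 1 \<Longrightarrow> distributed M lborel (\<zeta> k) (exponential_density 1)"
  shows "cdf (distr M borel (\<lambda>\<omega>. ((- ln (\<Sum>k=1..1. \<zeta> k \<omega>)) + (- ln (\<Sum>k=1..2. \<zeta> k \<omega>))) / sqrt 2)) x = limit_cdf (sqrt 2 * x)"
proof -
  have "indep_var (PiM {1} (\<lambda>_. borel)) (\<lambda>\<omega>. restrict (\<lambda>i. \<zeta> i \<omega>) {1}) (PiM {2} (\<lambda>_. borel)) (\<lambda>\<omega>. restrict (\<lambda>i. \<zeta> i \<omega>) {2})"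
    by (rule indep_var_restrict[OF indep]) auto
  from indep_var_compose[OF this, of "\<lambda>f. f 1" borel "\<lambda>f. f 2" borel]
  have iv: "indep_var borel (\<zeta> 1) borel (\<zeta> 2)" by (simp add: comp_def)
  have rv[measurable]: "\<zeta> 1 \<in> borel_measurable M" "\<zeta> 2 \<in> borel_measurable M"
    using iv by (auto dest: indep_var_rv1 indep_var_rv2)
  have law: "distr M borel (\<zeta> k) = exp_law" if "k \<ge> 1" for k
    using distributed_distr_eq_density[OF exp[OF that]] by (simp cong: distr_cong)
  have joint: "distr M (borel \<Otimes>\<^sub>M borel) (\<lambda>\<omega>. (\<zeta> 1 \<omega>, \<zeta> 2 \<omega>)) = exp_law \<Otimes>\<^sub>M exp_law"
    using iv unfolding indep_var_distribution_eq by (simp add: law)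
  have "{1..2::nat} = {1, 2}" by auto
  hence eq: "((- ln (\<Sum>k=1..1. \<zeta> k \<omega>)) + (- ln (\<Sum>k=1..2. \<zeta> k \<omega>))) / sqrt 2 \<le> x \<longleftrightarrow>
      - ln (\<zeta> 1 \<omega>) + - ln (\<zeta> 1 \<omega> + \<zeta> 2 \<omega>) \<le> sqrt 2 * x" for \<omega>
    by (simp add: pos_divide_le_eq mult.commute)
  have s2: "(\<lambda>\<omega>. (\<Sum>k=1..1. \<zeta> k \<omega>)) \<in> borel_measurable M" "(\<lambda>\<omega>. (\<Sum>k=1..2. \<zeta> k \<omega>)) \<in> borel_measurable M"
    using \<open>{1..2::nat} = {1, 2}\<close> rv[unfolded One_nat_def] by auto
  have "{x \<in> space (borel \<Otimes>\<^sub>M borel). - ln (fst x) + - ln (fst x + snd x) \<le> sqrt 2 * z} \<in> sets (borel \<Otimes>\<^sub>M borel :: (real \<times> real) measure)" for z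
    by measurable
  also have "{x \<in> space (borel \<Otimes>\<^sub>M borel). - ln (fst x) + - ln (fst x + snd x) \<le> z} = {(s, t). - ln s + - ln (s + t) \<le> z}" for z :: real
    by (auto simp: space_pair_measure)
  finally have sm: "{(s, t). - ln s + - ln (s + t) \<le> sqrt 2 * x} \<in> sets (borel \<Otimes>\<^sub>M borel :: (real \<times> real) measure)" .
  have "emeasure (distr M borel (\<lambda>\<omega>. ((- ln (\<Sum>k=1..1. \<zeta> k \<omega>)) + (- ln (\<Sum>k=1..2. \<zeta> k \<omega>))) / sqrt 2)) {..x} =
     emeasure M {\<omega> \<in> space M. - ln (\<zeta> 1 \<omega>) + - ln (\<zeta> 1 \<omega> + \<zeta> 2 \<omega>) \<le> sqrt 2 * x}"
  proof (subst emeasure_distr)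
    have "X -` {..x} \<inter> space M = {\<omega> \<in> space M. X \<omega> \<le> x}" for X by auto
    thus "emeasure M ((\<lambda>\<omega>. ((- ln (\<Sum>k=1..1. \<zeta> k \<omega>)) + (- ln (\<Sum>k=1..2. \<zeta> k \<omega>))) / sqrt 2) -` {..x} \<inter> space M) =
       emeasure M {\<omega> \<in> space M. - ln (\<zeta> 1 \<omega>) + - ln (\<zeta> 1 \<omega> + \<zeta> 2 \<omega>) \<le> sqrt 2 * x}"
      by (simp only: eq)
  qed (use s2 in auto)
  also have "\<dots> = emeasure (distr M (borel \<Otimes>\<^sub>M borel) (\<lambda>\<omega>. (\<zeta> 1 \<omega>, \<zeta> 2 \<omega>))) {(s, t). - ln s + - ln (s + t) \<le> sqrt 2 * x}"
    using sm rv[unfolded One_nat_def] by (subst emeasure_distr) (auto intro!: arg_cong[where f="emeasure M"])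
  also have "\<dots> = ennreal (limit_cdf (sqrt 2 * x))"
    unfolding joint by (rule exp_law_pair)
  finally have "emeasure (distr M borel (\<lambda>\<omega>. ((- ln (\<Sum>k=1..1. \<zeta> k \<omega>)) + (- ln (\<Sum>k=1..2. \<zeta> k \<omega>))) / sqrt 2)) {..x} = ennreal (limit_cdf (sqrt 2 * x))" .
  moreover have "limit_cdf y \<ge> 0" for y
    unfolding limit_cdf_def by (intro add_nonneg_nonneg Bochner_Integration.integral_nonneg) auto
  ultimately show ?thesis unfolding cdf_def measure_def by simp
qed

section \<open>The Gaussian model\<close>

text \<open>Completing the square: tilting the standard normal density by exp (a x) gives exp
  (a^2/2) times the normal density with mean a.\<close>

lemma mgf_std_normal:
  "integrable std_normal_distribution (\<lambda>x. exp (a * x))"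
  "(LINT x|std_normal_distribution. exp (a * x)) = exp (a\<^sup>2 / 2)"
proof -
  have e: "std_normal_density x * exp (a * x) = exp (a\<^sup>2 / 2) * normal_density a 1 x" for x
    by (simp add: normal_density_def mult_exp_exp power2_eq_square field_simps)
  show "integrable std_normal_distribution (\<lambda>x. exp (a * x))"
    by (subst integrable_real_density) (auto simp: e)
  show "(LINT x|std_normal_distribution. exp (a * x)) = exp (a\<^sup>2 / 2)"
    by (subst integral_real_density) (auto simp: e)
qed

text \<open>Chernoff bound. The sign of \<open>b\<close> is free and 0 is allowed, which covers both
  tails of the noise and the noiseless case r = 1/2.\<close>

lemma std_normal_tail_bound:
  assumes l: "l \<ge> 0"
  shows "measure std_normal_distribution {x. t \<le> b * x} \<le> exp (- l * t + l\<^sup>2 * b\<^sup>2 / 2)"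
proof -
  have m: "{x. t \<le> b * x} \<in> sets borel" by measurable
  have "measure std_normal_distribution {x. t \<le> b * x} = (LINT x|std_normal_distribution. indicator {x. t \<le> b * x} x)"
    by simp
  also have "\<dots> \<le> (LINT x|std_normal_distribution. exp (- l * t) * exp (l * b * x))"
  proof (rule integral_mono)
    show "integrable std_normal_distribution (indicator {x. t \<le> b * x} :: real \<Rightarrow> real)"
      using m by (intro integrable_real_indicator) (auto simp: std_normal.emeasure_eq_measure)
    show "integrable std_normal_distribution (\<lambda>x. exp (- l * t) * exp (l * b * x))"
      by (intro integrable_mult_right mgf_std_normal)
    show "indicator {x. t \<le> b * x} x \<le> exp (- l * t) * exp (l * b * x)" for x
    proof (cases "t \<le> b * x")
      case True
      hence "l * t \<le> l * (b * x)" using l by (rule mult_left_mono)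
      thus ?thesis using True by (simp add: mult_exp_exp mult.assoc)
    qed simp
  qed
  also have "\<dots> = exp (- l * t) * exp ((l * b)\<^sup>2 / 2)"
    by (simp only: integral_mult_right_zero mgf_std_normal)
  finally show ?thesis by (simp add: mult_exp_exp power_mult_distrib)
qed

section \<open>Representation by vertex variables and edge noise\<close>

lemma finite_pairs: "finite (pairs n)"
  by (rule finite_subset[of _ "{1..n} \<times> {1..n}"]) (auto simp: pairs_def)

lemma card_pairs_le: "card (pairs n) \<le> n\<^sup>2"
proof -
  have "card (pairs n) \<le> card ({1..n} \<times> {1..n})"
    by (intro card_mono) (auto simp: pairs_def)
  thus ?thesis by (simp add: power2_eq_square)
qed

abbreviation gauss_space :: "'i set \<Rightarrow> ('i \<Rightarrow> real) measure" where
  "gauss_space I \<equiv> PiM I (\<lambda>_. std_normal_distribution)"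

interpretation gauss: product_sigma_finite "\<lambda>_. std_normal_distribution"
proof -
  show "product_sigma_finite (\<lambda>_. std_normal_distribution)" by standard
qed

lemma prob_space_gauss_space: "prob_space (gauss_space I)"
  by (intro prob_space_PiM) (auto intro: prob_space_normal_density)

lemma gauss_space_component [measurable]: "i \<in> I \<Longrightarrow> (\<lambda>x. x i) \<in> borel_measurable (gauss_space I)"
  using measurable_component_singleton[of i I "\<lambda>_. std_normal_distribution"] by simp

lemma cis_sum: "finite I \<Longrightarrow> cis (\<Sum>i\<in>I. f i) = (\<Prod>i\<in>I. cis (f i))"
proof (induction I rule: finite_induct)
  case (insert x F)
  have "cis (f x + sum f F) = cis (f x) * cis (sum f F)" by (rule cis_mult[symmetric])
  thus ?case using insert by simp
qed simp

lemma integral_cis_std_normal: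
  "(LINT x|std_normal_distribution. cis (t * x)) = of_real (exp (- t\<^sup>2 / 2))"
  using fun_cong[OF char_std_normal_distribution, of t] unfolding char_def cis_conv_exp .

lemma integral_cis_gauss_space:
  assumes I: "finite I"
  shows "(LINT x|gauss_space I. cis (\<Sum>i\<in>I. u i * x i)) = of_real (exp (- (\<Sum>i\<in>I. (u i)\<^sup>2) / 2))"
proof -
  have "integrable std_normal_distribution (\<lambda>x. cis (u i * x))" for i
  proof (rule std_normal.integrable_const_bound[of _ 1])
    show "(\<lambda>x. cis (u i * x)) \<in> borel_measurable std_normal_distribution"
      by (rule measurable_compose[OF _ borel_measurable_cis]) simp
  qed simp
  hence "(LINT x|gauss_space I. (\<Prod>i\<in>I. cis (u i * x i))) = (\<Prod>i\<in>I. LINT x|std_normal_distribution. cis (u i * x))"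
    by (rule gauss.product_integral_prod[OF I, where f="\<lambda>i x. cis (u i * x)"])
  also have "\<dots> = (\<Prod>i\<in>I. of_real (exp (- (u i)\<^sup>2 / 2)))"
    by (simp only: integral_cis_std_normal)
  also have "\<dots> = of_real (exp (\<Sum>i\<in>I. - (u i)\<^sup>2 / 2))"
    by (simp only: exp_sum[OF I] of_real_prod)
  also have "(\<Sum>i\<in>I. - (u i)\<^sup>2 / 2) = - (\<Sum>i\<in>I. (u i)\<^sup>2) / 2"
    by (simp only: sum_negf sum_divide_distrib[symmetric])
  finally show ?thesis by (simp only: cis_sum[OF I])
qed

text \<open>The variance is 2r + (1 - 2r) = 1, pairs with one common vertex have covariance r and
  disjoint pairs are independent. The bound r <= 1/2 makes the noise variance nonnegative.\<close>

definition model_field :: "real \<Rightarrow> nat \<times> nat \<Rightarrow> (nat \<Rightarrow> real) \<times> (nat \<times> nat \<Rightarrow> real) \<Rightarrow> real" where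
  "model_field r p = (\<lambda>(x, z). sqrt r * (x (fst p) + x (snd p)) + sqrt (1 - 2 * r) * z p)"

abbreviation model_space :: "nat \<Rightarrow> ((nat \<Rightarrow> real) \<times> (nat \<times> nat \<Rightarrow> real)) measure" where
  "model_space n \<equiv> gauss_space {1..n} \<Otimes>\<^sub>M gauss_space (pairs n)"

lemma model_field_measurable:
  assumes "p \<in> pairs n"
  shows "model_field r p \<in> borel_measurable (model_space n)"
proof -
  have x: "(\<lambda>\<omega>. fst \<omega> i) \<in> borel_measurable (model_space n)" if "i \<in> {1..n}" for i
    using that by (intro measurable_compose[OF measurable_fst] gauss_space_component)
  have z: "(\<lambda>\<omega>. snd \<omega> p) \<in> borel_measurable (model_space n)"
    using assms by (intro measurable_compose[OF measurable_snd] gauss_space_component)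
  have "fst p \<in> {1..n}" "snd p \<in> {1..n}" using assms by (auto simp: pairs_def)
  thus ?thesis unfolding model_field_def case_prod_beta
    by (intro borel_measurable_add borel_measurable_times borel_measurable_const x z)
qed

text \<open>Vertex-edge incidence matrix of the complete graph, real valued so that the covariance
  becomes r times its Gram matrix plus a multiple of the identity.\<close>

definition incidence :: "nat \<Rightarrow> nat \<times> nat \<Rightarrow> real" where
  "incidence i p = (if i = fst p \<or> i = snd p then 1 else 0)"

lemma sum_incidence:
  assumes "p \<in> pairs n"
  shows "(\<Sum>i\<in>{1..n}. incidence i p * x i) = x (fst p) + x (snd p)"
proof -
  have "(\<Sum>i\<in>{1..n}. incidence i p * x i) = (\<Sum>i\<in>{fst p, snd p}. incidence i p * x i)"
    using assms by (intro sum.mono_neutral_right) (auto simp: incidence_def pairs_def)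
  moreover have "fst p \<noteq> snd p" using assms by (auto simp: pairs_def)
  hence "(\<Sum>i\<in>{fst p, snd p}. incidence i p * x i) = x (fst p) + x (snd p)"
    by (simp add: incidence_def)
  ultimately show ?thesis by simp
qed

text \<open>The sum counts common endpoints. As both pairs are increasing, two common endpoints
  force \<open>p = q\<close>, and then the value is 2r + (1 - 2r) = 1.\<close>

lemma cov_r_eq:
  assumes p: "p \<in> pairs n" and q: "q \<in> pairs n"
  shows "cov_r r p q = r * (\<Sum>i\<in>{1..n}. incidence i p * incidence i q) + (1 - 2 * r) * (if p = q then 1 else 0)"
proof -
  obtain i j k l where pq: "p = (i, j)" "q = (k, l)" by (cases p; cases q)
  hence ij: "i < j" "k < l" using p q by (auto simp: pairs_def)
  show ?thesis
    unfolding sum_incidence[OF p, of "\<lambda>i. incidence i q"] unfolding pq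
    using ij by (cases "i = k"; cases "i = l"; cases "j = k"; cases "j = l")
      (simp_all add: cov_r_def incidence_def)
qed

text \<open>One square per independent coordinate of the model, which is the form in which the
  exponent of its characteristic function arises.\<close>

lemma cov_r_quadratic_form:
  "(\<Sum>p\<in>pairs n. \<Sum>q\<in>pairs n. a p * a q * cov_r r p q) =
    r * (\<Sum>i\<in>{1..n}. (\<Sum>p\<in>pairs n. a p * incidence i p)\<^sup>2) + (1 - 2 * r) * (\<Sum>p\<in>pairs n. (a p)\<^sup>2)"
proof -
  have "(\<Sum>p\<in>pairs n. \<Sum>q\<in>pairs n. a p * a q * cov_r r p q) =
     (\<Sum>p\<in>pairs n. \<Sum>q\<in>pairs n. r * (\<Sum>i\<in>{1..n}. (a p * incidence i p) * (a q * incidence i q)) + (1 - 2 * r) * (if p = q then a p * a q else 0))"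
    by (intro sum.cong refl) (auto simp: cov_r_eq[of _ n] sum_distrib_left sum_distrib_right algebra_simps)
  also have "\<dots> = r * (\<Sum>p\<in>pairs n. \<Sum>q\<in>pairs n. \<Sum>i\<in>{1..n}. (a p * incidence i p) * (a q * incidence i q)) + (1 - 2 * r) * (\<Sum>p\<in>pairs n. \<Sum>q\<in>pairs n. (if p = q then a p * a q else 0))"
    by (simp only: sum.distrib sum_distrib_left)
  also have "(\<Sum>p\<in>pairs n. \<Sum>q\<in>pairs n. (if p = q then a p * a q else 0)) = (\<Sum>p\<in>pairs n. (a p)\<^sup>2)"
    by (simp add: finite_pairs power2_eq_square)
  also have "(\<Sum>p\<in>pairs n. \<Sum>q\<in>pairs n. \<Sum>i\<in>{1..n}. (a p * incidence i p) * (a q * incidence i q)) =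
     (\<Sum>p\<in>pairs n. \<Sum>i\<in>{1..n}. \<Sum>q\<in>pairs n. (a p * incidence i p) * (a q * incidence i q))"
    by (intro sum.cong refl) (rule sum.swap)
  also have "\<dots> = (\<Sum>i\<in>{1..n}. \<Sum>p\<in>pairs n. \<Sum>q\<in>pairs n. (a p * incidence i p) * (a q * incidence i q))"
    by (rule sum.swap)
  also have "\<dots> = (\<Sum>i\<in>{1..n}. (\<Sum>p\<in>pairs n. a p * incidence i p)\<^sup>2)"
    by (simp only: power2_eq_square sum_product)
  finally show ?thesis .
qed

lemma model_field_char:
  assumes r: "0 \<le> r" "r \<le> 1/2"
  shows "(LINT \<omega>|model_space n. cis (\<Sum>p\<in>pairs n. a p * model_field r p \<omega>)) =
    of_real (exp (- (\<Sum>p\<in>pairs n. \<Sum>q\<in>pairs n. a p * a q * cov_r r p q) / 2))"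
proof -
  interpret X: prob_space "gauss_space {1..n}" by (rule prob_space_gauss_space)
  interpret Z: prob_space "gauss_space (pairs n)" by (rule prob_space_gauss_space)
  interpret XZ: pair_prob_space "gauss_space {1..n}" "gauss_space (pairs n)" ..
  \<comment> \<open>Coefficients of the vertex variable \<open>i\<close> and of the edge variable
    \<open>p\<close> after regrouping the linear combination of the field by independent
    coordinates.\<close>
  define u where "u i = sqrt r * (\<Sum>p\<in>pairs n. a p * incidence i p)" for i
  define v where "v p = sqrt (1 - 2 * r) * a p" for p
  have split: "(\<Sum>p\<in>pairs n. a p * model_field r p (x, z)) = (\<Sum>i\<in>{1..n}. u i * x i) + (\<Sum>p\<in>pairs n. v p * z p)" for x z
  proof -
    have "(\<Sum>p\<in>pairs n. a p * model_field r p (x, z)) =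
        (\<Sum>p\<in>pairs n. sqrt r * (\<Sum>i\<in>{1..n}. a p * incidence i p * x i)) + (\<Sum>p\<in>pairs n. v p * z p)"
      unfolding sum.distrib[symmetric]
    proof (intro sum.cong refl)
      fix p assume p: "p \<in> pairs n"
      have "(\<Sum>i\<in>{1..n}. a p * incidence i p * x i) = a p * (x (fst p) + x (snd p))"
        unfolding sum_incidence[OF p, symmetric] by (simp only: sum_distrib_left mult.assoc)
      thus "a p * model_field r p (x, z) = sqrt r * (\<Sum>i\<in>{1..n}. a p * incidence i p * x i) + v p * z p"
        by (simp add: model_field_def v_def algebra_simps)
    qed
    also have "(\<Sum>p\<in>pairs n. sqrt r * (\<Sum>i\<in>{1..n}. a p * incidence i p * x i)) = (\<Sum>i\<in>{1..n}. u i * x i)"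
      unfolding u_def sum_distrib_left sum_distrib_right by (subst sum.swap) (simp add: mult_ac)
    finally show ?thesis .
  qed
  have int: "integrable (model_space n) (\<lambda>\<omega>. cis (\<Sum>p\<in>pairs n. a p * model_field r p \<omega>))"
    using model_field_measurable[of _ n r]
    by (intro XZ.P.integrable_const_bound[of _ 1] measurable_compose[OF _ borel_measurable_cis]) auto
  have "(LINT \<omega>|model_space n. cis (\<Sum>p\<in>pairs n. a p * model_field r p \<omega>)) =
     (LINT x|gauss_space {1..n}. LINT z|gauss_space (pairs n). cis (\<Sum>p\<in>pairs n. a p * model_field r p (x, z)))"
    by (rule XZ.integral_fst'[OF int, symmetric])
  also have "\<dots> = (LINT x|gauss_space {1..n}. cis (\<Sum>i\<in>{1..n}. u i * x i)) * (LINT z|gauss_space (pairs n). cis (\<Sum>p\<in>pairs n. v p * z p))"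
    unfolding split cis_mult[symmetric] by simp
  also have "\<dots> = of_real (exp (- (\<Sum>i\<in>{1..n}. (u i)\<^sup>2) / 2) * exp (- (\<Sum>p\<in>pairs n. (v p)\<^sup>2) / 2))"
    by (simp only: integral_cis_gauss_space finite_pairs finite_atLeastAtMost of_real_mult)
  also have "exp (- (\<Sum>i\<in>{1..n}. (u i)\<^sup>2) / 2) * exp (- (\<Sum>p\<in>pairs n. (v p)\<^sup>2) / 2) =
     exp (- ((\<Sum>i\<in>{1..n}. (u i)\<^sup>2) + (\<Sum>p\<in>pairs n. (v p)\<^sup>2)) / 2)"
    by (simp add: mult_exp_exp add_divide_distrib)
  also have "(\<Sum>i\<in>{1..n}. (u i)\<^sup>2) + (\<Sum>p\<in>pairs n. (v p)\<^sup>2) = (\<Sum>p\<in>pairs n. \<Sum>q\<in>pairs n. a p * a q * cov_r r p q)"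
    unfolding cov_r_quadratic_form u_def v_def power_mult_distrib sum_distrib_left[symmetric] using r by simp
  finally show ?thesis .
qed

text \<open>Conditioning on the first component: sections over the exceptional set \<open>S\<close>
  are bounded by 1, all others by \<open>h\<close>. Both comparisons of the model with its vertex
  sums have this shape.\<close>

lemma measure_pair_le:
  fixes h :: "'a \<Rightarrow> real"
  assumes A: "prob_space A" and B: "prob_space B" and E: "E \<in> sets (A \<Otimes>\<^sub>M B)" and S: "S \<in> sets A"
    and h: "integrable A h" "\<And>x. 0 \<le> h x" and le: "\<And>x. x \<in> space A \<Longrightarrow> x \<notin> S \<Longrightarrow> measure B (Pair x -` E) \<le> h x"
  shows "measure (A \<Otimes>\<^sub>M B) E \<le> measure A S + (LINT x|A. h x)"
proof -
  interpret A: prob_space A by fact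
  interpret B: prob_space B by fact
  interpret P: pair_prob_space A B ..
  have "emeasure (A \<Otimes>\<^sub>M B) E = (\<integral>\<^sup>+x. emeasure B (Pair x -` E) \<partial>A)"
    by (rule B.emeasure_pair_measure_alt[OF E])
  also have "\<dots> \<le> (\<integral>\<^sup>+x. indicator S x + ennreal (h x) \<partial>A)"
  proof (rule nn_integral_mono)
    fix x assume x: "x \<in> space A"
    show "emeasure B (Pair x -` E) \<le> indicator S x + ennreal (h x)"
    proof (cases "x \<in> S")
      case True
      have "emeasure B (Pair x -` E) \<le> 1" by (rule B.emeasure_le_1)
      also have "\<dots> \<le> indicator S x + ennreal (h x)" using True by simp
      finally show ?thesis .
    next
      case False
      thus ?thesis using le[OF x] by (simp add: B.emeasure_eq_measure ennreal_leI)
    qed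
  qed
  also have "\<dots> = emeasure A S + ennreal (LINT x|A. h x)"
    using S h by (subst nn_integral_add) (auto simp: nn_integral_eq_integral)
  also have "\<dots> = ennreal (measure A S + (LINT x|A. h x))"
    using h by (simp add: A.emeasure_eq_measure ennreal_plus Bochner_Integration.integral_nonneg)
  finally show ?thesis
    unfolding P.P.emeasure_eq_measure
    using h by (subst (asm) ennreal_le_iff) (auto intro!: add_nonneg_nonneg Bochner_Integration.integral_nonneg)
qed

lemma measure_gauss_space_component:
  assumes i: "i \<in> I" and A: "A \<in> sets borel"
  shows "measure (gauss_space I) {x \<in> space (gauss_space I). x i \<in> A} = measure std_normal_distribution A"
proof -
  interpret G: product_prob_space "\<lambda>_. std_normal_distribution" I ..
  have "measure std_normal_distribution A = measure (distr (gauss_space I) std_normal_distribution (\<lambda>x. x i)) A"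
    using G.PiM_component[OF i] by simp
  also have "\<dots> = measure (gauss_space I) ((\<lambda>x. x i) -` A \<inter> space (gauss_space I))"
    using i A by (intro measure_distr) auto
  also have "(\<lambda>x. x i) -` A \<inter> space (gauss_space I) = {x \<in> space (gauss_space I). x i \<in> A}"
    by auto
  finally show ?thesis ..
qed

lemma gauss_space_component_sets:
  assumes "i \<in> I" "A \<in> sets borel"
  shows "{x \<in> space (gauss_space I). x i \<in> A} \<in> sets (gauss_space I)"
proof -
  have "(\<lambda>x. x i) -` A \<inter> space (gauss_space I) \<in> sets (gauss_space I)"
    by (rule measurable_sets[OF gauss_space_component[OF assms(1)] assms(2)])
  also have "(\<lambda>x. x i) -` A \<inter> space (gauss_space I) = {x \<in> space (gauss_space I). x i \<in> A}" by blast
  finally show ?thesis .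
qed

lemma affine_halfline_borel: "{y. (t::real) \<le> b * y} \<in> sets borel"
  by measurable

lemma pair_sums_sets:
  "{x \<in> space (gauss_space {1..n}). \<forall>p\<in>pairs n. x (fst p) + x (snd p) \<le> v} \<in> sets (gauss_space {1..n})"
  by (intro sets.sets_Collect_finite_All finite_pairs borel_measurable_le borel_measurable_add borel_measurable_const gauss_space_component)
    (auto simp: pairs_def)

lemma model_field_le_sets:
  "{\<omega> \<in> space (model_space n). \<forall>p\<in>pairs n. model_field r p \<omega> \<le> u} \<in> sets (model_space n)"
  by (intro sets.sets_Collect_finite_All finite_pairs borel_measurable_le borel_measurable_const model_field_measurable)

text \<open>If some vertex sum exceeds v, one such pair p is fixed. Given x this choice is
  deterministic, so the noise at this single p must be very negative and no sum over pairs appears.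
  The rate \<open>l\<close> stays free.\<close>

lemma model_cdf_upper:
  assumes r: "0 \<le> r" "r \<le> 1/2" and l: "l \<ge> 0"
  shows "measure (model_space n) {\<omega> \<in> space (model_space n). \<forall>p\<in>pairs n. model_field r p \<omega> \<le> u} \<le>
    measure (gauss_space {1..n}) {x \<in> space (gauss_space {1..n}). \<forall>p\<in>pairs n. x (fst p) + x (snd p) \<le> v}
    + exp (- l * (sqrt r * v - u) + l\<^sup>2 * (1 - 2 * r) / 2)"
proof -
  interpret X: prob_space "gauss_space {1..n}" by (rule prob_space_gauss_space)
  interpret Z: prob_space "gauss_space (pairs n)" by (rule prob_space_gauss_space)
  define C where "C = exp (- l * (sqrt r * v - u) + l\<^sup>2 * (1 - 2 * r) / 2)"
  define S where "S = {x \<in> space (gauss_space {1..n}). \<forall>p\<in>pairs n. x (fst p) + x (snd p) \<le> v}"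
  have "measure (model_space n) {\<omega> \<in> space (model_space n). \<forall>p\<in>pairs n. model_field r p \<omega> \<le> u} \<le>
    measure (gauss_space {1..n}) S + (LINT x|gauss_space {1..n}. C)"
  proof (rule measure_pair_le[OF prob_space_gauss_space prob_space_gauss_space model_field_le_sets])
    show "S \<in> sets (gauss_space {1..n})" unfolding S_def by (rule pair_sums_sets)
    fix x assume x: "x \<in> space (gauss_space {1..n})" "x \<notin> S"
    then obtain p where p: "p \<in> pairs n" "v < x (fst p) + x (snd p)" by (auto simp: S_def not_le)
    have "sqrt r * v \<le> sqrt r * (x (fst p) + x (snd p))"
      using p r by (intro mult_left_mono) auto
    \<comment> \<open>A low value of the noise is an upper-tail event for its negative, hence the
      negative coefficient.\<close>
    hence sub: "Pair x -` {\<omega> \<in> space (model_space n). \<forall>p\<in>pairs n. model_field r p \<omega> \<le> u}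
        \<subseteq> {z \<in> space (gauss_space (pairs n)). z p \<in> {y. sqrt r * v - u \<le> (- sqrt (1 - 2 * r)) * y}}"
    proof (intro subsetI)
      fix z assume "z \<in> Pair x -` {\<omega> \<in> space (model_space n). \<forall>p\<in>pairs n. model_field r p \<omega> \<le> u}"
      hence "z \<in> space (gauss_space (pairs n))" "model_field r p (x, z) \<le> u"
        using p(1) by (auto simp only: vimage_eq mem_Collect_eq space_pair_measure mem_Times_iff snd_conv)
      moreover from this(2) have "sqrt r * v - u \<le> (- sqrt (1 - 2 * r)) * z p"
        using \<open>sqrt r * v \<le> _\<close> by (simp add: model_field_def)
      ultimately show "z \<in> {z \<in> space (gauss_space (pairs n)). z p \<in> {y. sqrt r * v - u \<le> (- sqrt (1 - 2 * r)) * y}}"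
        by blast
    qed
    have "measure (gauss_space (pairs n)) (Pair x -` {\<omega> \<in> space (model_space n). \<forall>p\<in>pairs n. model_field r p \<omega> \<le> u})
        \<le> measure (gauss_space (pairs n)) {z \<in> space (gauss_space (pairs n)). z p \<in> {y. sqrt r * v - u \<le> (- sqrt (1 - 2 * r)) * y}}"
      using p by (intro Z.finite_measure_mono[OF sub] gauss_space_component_sets affine_halfline_borel)
    also have "\<dots> = measure std_normal_distribution {y. sqrt r * v - u \<le> (- sqrt (1 - 2 * r)) * y}"
      by (rule measure_gauss_space_component[OF p(1) affine_halfline_borel])
    also have "\<dots> \<le> exp (- l * (sqrt r * v - u) + l\<^sup>2 * (- sqrt (1 - 2 * r))\<^sup>2 / 2)"
      by (rule std_normal_tail_bound[OF l, where t="sqrt r * v - u" and b="- sqrt (1 - 2 * r)"])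
    also have "\<dots> = C" using r by (simp add: C_def)
    finally show "measure (gauss_space (pairs n)) (Pair x -` {\<omega> \<in> space (model_space n). \<forall>p\<in>pairs n. model_field r p \<omega> \<le> u}) \<le> C" .
  qed (auto simp only: C_def exp_ge_zero intro!: X.integrable_const)
  thus ?thesis unfolding Bochner_Integration.lebesgue_integral_const X.prob_space by (simp add: C_def S_def)
qed

lemma gauss_space_exceed_le:
  "measure (gauss_space {1..n}) {x \<in> space (gauss_space {1..n}). \<exists>i\<in>{1..n}. t < x i} \<le>
    real n * (1 - cdf std_normal_distribution t)"
proof -
  interpret X: prob_space "gauss_space {1..n}" by (rule prob_space_gauss_space)
  have m: "{x \<in> space (gauss_space {1..n}). x i \<in> {t<..}} \<in> sets (gauss_space {1..n})" if "i \<in> {1..n}" for i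
    by (rule gauss_space_component_sets[OF that]) simp
  have c: "measure std_normal_distribution {t<..} = 1 - cdf std_normal_distribution t"
    using std_normal.prob_compl[of "{..t}"] by (simp add: cdf_def Compl_eq_Diff_UNIV[symmetric] Compl_atMost)
  have "{x \<in> space (gauss_space {1..n}). \<exists>i\<in>{1..n}. t < x i} = (\<Union>i\<in>{1..n}. {x \<in> space (gauss_space {1..n}). x i \<in> {t<..}})"
    by blast
  also have "measure (gauss_space {1..n}) \<dots> \<le> (\<Sum>i\<in>{1..n}. measure (gauss_space {1..n}) {x \<in> space (gauss_space {1..n}). x i \<in> {t<..}})"
    using m by (intro X.finite_measure_subadditive_finite) auto
  also have "\<dots> = (\<Sum>i\<in>{1..n}. measure std_normal_distribution {t<..})"
    by (rule sum.cong[OF refl]) (rule measure_gauss_space_component, simp_all)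
  finally show ?thesis by (simp add: c)
qed

lemma gauss_space_two_point_integral:
  fixes w :: "real \<Rightarrow> real"
  assumes I: "finite I" "i \<in> I" "j \<in> I" "i \<noteq> j" and w: "integrable std_normal_distribution w"
  shows "integrable (gauss_space I) (\<lambda>x. w (x i) * w (x j))"
    and "(LINT x|gauss_space I. w (x i) * w (x j)) = (LINT y|std_normal_distribution. w y)\<^sup>2"
proof -
  \<comment> \<open>Padding with the constant 1 away from i and j writes the integrand as a product
    over all coordinates.\<close>
  define f where "f k = (if k = i \<or> k = j then w else (\<lambda>_. 1))" for k
  have f: "integrable std_normal_distribution (f k)" for k using w by (simp add: f_def)
  have two: "(\<Prod>k\<in>I. g k) = g i * g j" if "\<And>k. k \<in> I \<Longrightarrow> k \<noteq> i \<Longrightarrow> k \<noteq> j \<Longrightarrow> g k = 1" for g :: "'a \<Rightarrow> real"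
  proof -
    have "(\<Prod>k\<in>I. g k) = (\<Prod>k\<in>{i, j}. g k)"
      using I that by (intro prod.mono_neutral_right) auto
    thus ?thesis using I by simp
  qed
  have e: "(\<lambda>x. \<Prod>k\<in>I. f k (x k)) = (\<lambda>x. w (x i) * w (x j))"
    by (intro ext, subst two) (auto simp: f_def)
  show "integrable (gauss_space I) (\<lambda>x. w (x i) * w (x j))"
    using gauss.product_integrable_prod[OF I(1), where f=f, OF f] unfolding e .
  have "(LINT x|gauss_space I. (\<Prod>k\<in>I. f k (x k))) = (\<Prod>k\<in>I. integral\<^sup>L std_normal_distribution (f k))"
    by (rule gauss.product_integral_prod[OF I(1), where f=f, OF f])
  also have "\<dots> = (LINT y|std_normal_distribution. w y)\<^sup>2"
    by (subst two) (auto simp: f_def power2_eq_square std_normal.prob_space[simplified])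
  finally show "(LINT x|gauss_space I. w (x i) * w (x j)) = (LINT y|std_normal_distribution. w y)\<^sup>2"
    unfolding e .
qed

text \<open>The right side collects three ways to exceed u: a vertex sum above v, a vertex variable
  above \<open>T'\<close>, or noise bridging the gap from a lower vertex sum to u. The Chernoff
  exponent for the last is B times the rescaled gap. Two of these B units produce the weights exp (2
  c (x - d)) at both endpoints; the other B - 2 give a factor that is small for large B when
  \<epsilon> > 0, as the gap is at least sqrt 2 * \<epsilon>.\<close>

lemma model_cdf_lower:
  assumes r: "0 < r" "r \<le> 1/2" and c: "c > 0" and B: "B \<ge> 2" and T: "T' < T"
    and u: "u = sqrt 2 * d + z / c" "u \<ge> 0" and v: "v = 2 * d + sqrt 2 * (z - \<epsilon>) / c"
  shows "1 - measure (model_space n) {\<omega> \<in> space (model_space n). \<forall>p\<in>pairs n. model_field r p \<omega> \<le> u} \<le>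
    (1 - measure (gauss_space {1..n}) {x \<in> space (gauss_space {1..n}). \<forall>p\<in>pairs n. x (fst p) + x (snd p) \<le> v})
    + real n * (1 - cdf std_normal_distribution T')
    + exp (B\<^sup>2 * (c\<^sup>2 * (1 - 2 * r)) / (2 * r) - (B - 2) * (sqrt 2 * \<epsilon>) - 2 * sqrt 2 * z) *
      (real n * (LINT x|std_normal_distribution. indicator {..<T} x * exp (2 * (c * (x - d)))))\<^sup>2"
proof -
  interpret X: prob_space "gauss_space {1..n}" by (rule prob_space_gauss_space)
  interpret Z: prob_space "gauss_space (pairs n)" by (rule prob_space_gauss_space)
  interpret XZ: pair_prob_space "gauss_space {1..n}" "gauss_space (pairs n)" ..
  define w where "w x = indicator {..<T} x * exp (2 * (c * (x - d)))" for x :: real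
  define q where "q = (LINT x|std_normal_distribution. w x)"
  define C where "C = exp (B\<^sup>2 * (c\<^sup>2 * (1 - 2 * r)) / (2 * r) - (B - 2) * (sqrt 2 * \<epsilon>) - 2 * sqrt 2 * z)"
  \<comment> \<open>The division by sqrt r compensates the factor sqrt r of the vertex part, so that
    the exponent becomes B times the gap \<open>Y\<close> below.\<close>
  define l where "l = B * c / sqrt r"
  have l: "l \<ge> 0" using B c r by (simp add: l_def)
  have l2: "l\<^sup>2 * (1 - 2 * r) / 2 = B\<^sup>2 * (c\<^sup>2 * (1 - 2 * r)) / (2 * r)"
    using r by (simp add: l_def power_divide power_mult_distrib)
  have w_meas: "w \<in> borel_measurable borel"
    unfolding w_def[abs_def]
    by (intro borel_measurable_times borel_measurable_indicator borel_measurable_continuous_onI continuous_intros) simp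
  have wi: "integrable std_normal_distribution w"
  proof (rule std_normal.integrable_const_bound[of _ "exp (2 * (c * (T - d)))"])
    show "w \<in> borel_measurable std_normal_distribution" by (simp add: w_meas)
    show "AE x in std_normal_distribution. norm (w x) \<le> exp (2 * (c * (T - d)))"
    proof (rule AE_I2)
      fix x
      show "norm (w x) \<le> exp (2 * (c * (T - d)))"
      proof (cases "x < T")
        case True
        hence "c * (x - d) \<le> c * (T - d)" using c by (intro mult_left_mono) auto
        thus ?thesis using True by (simp add: w_def)
      qed (simp add: w_def)
    qed
  qed
  define A where "A = {\<omega> \<in> space (model_space n). \<forall>p\<in>pairs n. model_field r p \<omega> \<le> u}"
  define S1 where "S1 = {x \<in> space (gauss_space {1..n}). \<forall>p\<in>pairs n. x (fst p) + x (snd p) \<le> v}"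
  define S2 where "S2 = {x \<in> space (gauss_space {1..n}). \<exists>i\<in>{1..n}. T' < x i}"
  define h where "h x = (\<Sum>p\<in>pairs n. C * (w (x (fst p)) * w (x (snd p))))" for x
  have Am: "A \<in> sets (model_space n)" unfolding A_def by (rule model_field_le_sets)
  have S1m: "S1 \<in> sets (gauss_space {1..n})" unfolding S1_def by (rule pair_sums_sets)
  have S2m: "S2 \<in> sets (gauss_space {1..n})" unfolding S2_def
    by (intro sets.sets_Collect_finite_Ex borel_measurable_less borel_measurable_const gauss_space_component) auto
  have pn: "fst p \<in> {1..n}" "snd p \<in> {1..n}" "fst p \<noteq> snd p" if "p \<in> pairs n" for p
    using that by (auto simp: pairs_def)
  have hi: "integrable (gauss_space {1..n}) h"
    unfolding h_def using pn
    by (intro Bochner_Integration.integrable_sum integrable_mult_right gauss_space_two_point_integral(1)[OF _ _ _ _ wi]) auto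
  have "(LINT x|gauss_space {1..n}. h x) = (\<Sum>p\<in>pairs n. LINT x|gauss_space {1..n}. C * (w (x (fst p)) * w (x (snd p))))"
    unfolding h_def using pn
    by (intro Bochner_Integration.integral_sum integrable_mult_right gauss_space_two_point_integral(1)[OF _ _ _ _ wi]) auto
  also have "\<dots> = (\<Sum>p\<in>pairs n. C * q\<^sup>2)"
  proof (intro sum.cong refl)
    fix p assume p: "p \<in> pairs n"
    show "(LINT x|gauss_space {1..n}. C * (w (x (fst p)) * w (x (snd p)))) = C * q\<^sup>2"
      using gauss_space_two_point_integral(2)[OF finite_atLeastAtMost pn[OF p] wi] by (simp add: q_def)
  qed
  also have "\<dots> = C * (real (card (pairs n)) * q\<^sup>2)" by simp
  \<comment> \<open>Bounding the number of pairs by n^2 loses a factor of about 2 but turns the sum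
    into the square of n times a one-point moment.\<close>
  also have "\<dots> \<le> C * (real (n\<^sup>2) * q\<^sup>2)"
    using card_pairs_le[of n] by (intro mult_left_mono mult_right_mono) (auto simp: C_def simp del: of_nat_power)
  also have "real (n\<^sup>2) * q\<^sup>2 = (real n * q)\<^sup>2" by (simp add: power_mult_distrib)
  finally have hint: "(LINT x|gauss_space {1..n}. h x) \<le> C * (real n * q)\<^sup>2" .
  have "measure (model_space n) (space (model_space n) - A) \<le> measure (gauss_space {1..n}) ((space (gauss_space {1..n}) - S1) \<union> S2) + (LINT x|gauss_space {1..n}. h x)"
  proof (rule measure_pair_le[OF prob_space_gauss_space prob_space_gauss_space])
    show "integrable (gauss_space {1..n}) h" by fact
    show "0 \<le> h x" for x unfolding h_def by (intro sum_nonneg) (auto simp: C_def w_def)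
    fix x assume x: "x \<in> space (gauss_space {1..n})" "x \<notin> (space (gauss_space {1..n}) - S1) \<union> S2"
    \<comment> \<open>The weight \<open>w\<close> vanishes from \<open>T\<close> on, while being
      outside \<open>S2\<close> gives only <= \<open>T'\<close>; hence the two levels
      \<open>T' < T\<close>.\<close>
    hence s: "x (fst p) + x (snd p) \<le> v" "x (fst p) < T" "x (snd p) < T" if "p \<in> pairs n" for p
    proof -
      have "x \<in> S1" "x \<notin> S2" using x by auto
      hence "\<forall>p\<in>pairs n. x (fst p) + x (snd p) \<le> v" "\<forall>i\<in>{1..n}. x i \<le> T'"
        using x(1) by (simp_all add: S1_def S2_def not_less)
      hence "x (fst p) + x (snd p) \<le> v" "x (fst p) \<le> T'" "x (snd p) \<le> T'"
        using that pn[OF that] by blast+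
      thus "x (fst p) + x (snd p) \<le> v" "x (fst p) < T" "x (snd p) < T" using T by linarith+
    qed
    define D where "D p = {z \<in> space (gauss_space (pairs n)). z p \<in> {y. u - sqrt r * (x (fst p) + x (snd p)) \<le> sqrt (1 - 2 * r) * y}}" for p
    have Dm: "D p \<in> sets (gauss_space (pairs n))" if "p \<in> pairs n" for p
      unfolding D_def by (rule gauss_space_component_sets[OF that affine_halfline_borel])
    have "measure (gauss_space (pairs n)) (Pair x -` (space (model_space n) - A)) \<le> measure (gauss_space (pairs n)) (\<Union>p\<in>pairs n. D p)"
    proof (rule Z.finite_measure_mono)
      show "(\<Union>p\<in>pairs n. D p) \<in> sets (gauss_space (pairs n))"
        using Dm finite_pairs by (intro sets.finite_UN)
      show "Pair x -` (space (model_space n) - A) \<subseteq> (\<Union>p\<in>pairs n. D p)"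
      proof (intro subsetI)
        fix z assume "z \<in> Pair x -` (space (model_space n) - A)"
        hence z: "(x, z) \<in> space (model_space n)" "(x, z) \<notin> A" by auto
        hence "\<not> (\<forall>p\<in>pairs n. model_field r p (x, z) \<le> u)" unfolding A_def by blast
        then obtain p where p: "p \<in> pairs n" "\<not> model_field r p (x, z) \<le> u" by blast
        from p(2) have "u - sqrt r * (x (fst p) + x (snd p)) \<le> sqrt (1 - 2 * r) * z p"
          by (simp add: model_field_def not_le)
        moreover have "z \<in> space (gauss_space (pairs n))"
          using z(1) by (simp only: space_pair_measure mem_Times_iff snd_conv)
        ultimately have "z \<in> D p" unfolding D_def by blast
        thus "z \<in> (\<Union>p\<in>pairs n. D p)" using p(1) by blast
      qed
    qed
    also have "\<dots> \<le> (\<Sum>p\<in>pairs n. measure (gauss_space (pairs n)) (D p))"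
      using Dm finite_pairs by (intro Z.finite_measure_subadditive_finite) auto
    also have "\<dots> \<le> h x"
      unfolding h_def
    proof (rule sum_mono)
      fix p assume p: "p \<in> pairs n"
      define y where "y = x (fst p) + x (snd p)"
      have "measure (gauss_space (pairs n)) (D p) = measure std_normal_distribution {t. u - sqrt r * y \<le> sqrt (1 - 2 * r) * t}"
        unfolding D_def y_def by (rule measure_gauss_space_component[OF p affine_halfline_borel])
      also have "\<dots> \<le> exp (- l * (u - sqrt r * y) + l\<^sup>2 * (sqrt (1 - 2 * r))\<^sup>2 / 2)"
        by (rule std_normal_tail_bound[OF l, where t="u - sqrt r * y" and b="sqrt (1 - 2 * r)"])
      also have "\<dots> \<le> C * (w (x (fst p)) * w (x (snd p)))"
      proof -
        \<comment> \<open>Rescaled distance of the vertex sum y from sqrt 2 * u, the level it would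
          have to pass without noise at r = 1/2.\<close>
        define Y where "Y = c * (sqrt 2 * u - y)"
        have sq: "sqrt 2 * sqrt 2 = (2::real)" by simp
        have Y1: "Y = sqrt 2 * z + 2 * c * d - c * y"
        proof -
          have "Y = (sqrt 2 * sqrt 2) * c * d + sqrt 2 * z - c * y" using c by (simp add: Y_def u(1) algebra_simps)
          thus ?thesis by simp
        qed
        have "c * y \<le> c * v" using s(1)[OF p] c by (simp add: y_def)
        also have "c * v = 2 * c * d + sqrt 2 * (z - \<epsilon>)" using c by (simp add: v field_simps)
        finally have Y2: "sqrt 2 * \<epsilon> \<le> Y" unfolding Y1 by (simp add: algebra_simps)
        \<comment> \<open>Since sqrt (2r) <= 1 and u >= 0, the level u may be lowered to sqrt (2r) *
          u, which makes sqrt r a common factor.\<close>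
        have "sqrt r * sqrt 2 \<le> 1" using r by (simp add: real_sqrt_mult[symmetric])
        hence "sqrt r * sqrt 2 * u \<le> 1 * u" using u(2) by (intro mult_right_mono)
        hence "l * (sqrt r * sqrt 2 * u - sqrt r * y) \<le> l * (u - sqrt r * y)"
          using l by (intro mult_left_mono) auto
        also have "l * (sqrt r * sqrt 2 * u - sqrt r * y) = B * Y"
          using r by (simp add: l_def Y_def field_simps)
        also have "B * Y = (B - 2) * Y + 2 * Y" by (simp add: algebra_simps)
        finally have "(B - 2) * Y + 2 * Y \<le> l * (u - sqrt r * y)" .
        moreover have "(B - 2) * (sqrt 2 * \<epsilon>) \<le> (B - 2) * Y" using Y2 B by (intro mult_left_mono) auto
        ultimately have "- l * (u - sqrt r * y) + l\<^sup>2 * (sqrt (1 - 2 * r))\<^sup>2 / 2 \<le>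
           (B\<^sup>2 * (c\<^sup>2 * (1 - 2 * r)) / (2 * r) - (B - 2) * (sqrt 2 * \<epsilon>) - 2 * sqrt 2 * z) + (2 * (c * (x (fst p) - d)) + 2 * (c * (x (snd p) - d)))"
        proof -
          have "l\<^sup>2 * (sqrt (1 - 2 * r))\<^sup>2 / 2 = B\<^sup>2 * (c\<^sup>2 * (1 - 2 * r)) / (2 * r)"
            using r unfolding l2[symmetric] by simp
          moreover have "2 * Y = 2 * sqrt 2 * z - (2 * (c * (x (fst p) - d)) + 2 * (c * (x (snd p) - d)))"
            unfolding Y1 y_def by (simp add: algebra_simps)
          moreover have "- l * (u - sqrt r * y) = - (l * (u - sqrt r * y))" by simp
          ultimately show ?thesis
            using \<open>(B - 2) * Y + 2 * Y \<le> _\<close> \<open>(B - 2) * (sqrt 2 * \<epsilon>) \<le> _\<close> by linarith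
        qed
        thus ?thesis using s(2,3)[OF p] by (simp add: C_def w_def mult_exp_exp)
      qed
      finally show "measure (gauss_space (pairs n)) (D p) \<le> C * (w (x (fst p)) * w (x (snd p)))" .
    qed
    finally show "measure (gauss_space (pairs n)) (Pair x -` (space (model_space n) - A)) \<le> h x" .
  qed (use Am S1m S2m in auto)
  also have "measure (gauss_space {1..n}) ((space (gauss_space {1..n}) - S1) \<union> S2) \<le>
      measure (gauss_space {1..n}) (space (gauss_space {1..n}) - S1) + measure (gauss_space {1..n}) S2"
    using S1m S2m by (intro measure_Un_le) auto
  also have "measure (gauss_space {1..n}) (space (gauss_space {1..n}) - S1) = 1 - measure (gauss_space {1..n}) S1"
    using S1m by (rule X.prob_compl)
  also have "measure (gauss_space {1..n}) S2 \<le> real n * (1 - cdf std_normal_distribution T')"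
    unfolding S2_def by (rule gauss_space_exceed_le)
  finally have "measure (model_space n) (space (model_space n) - A) \<le>
     1 - measure (gauss_space {1..n}) S1 + real n * (1 - cdf std_normal_distribution T') + C * (real n * q)\<^sup>2"
    using hint by simp
  moreover have "measure (model_space n) (space (model_space n) - A) = 1 - measure (model_space n) A"
    using XZ.P.prob_compl[OF Am] .
  ultimately show ?thesis by (simp add: A_def S1_def C_def q_def w_def)
qed

section \<open>Convergence\<close>

definition pair_sum_cdf :: "nat \<Rightarrow> real \<Rightarrow> real" where
  "pair_sum_cdf n v = measure (gauss_space {1..n})
     {x \<in> space (gauss_space {1..n}). \<forall>p\<in>pairs n. x (fst p) + x (snd p) \<le> v}"

text \<open>The exact formula \<open>measure_PiM_pair_sums_le\<close> is used at a level whose half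
  is d_n + (z/2)/c_n; the substitution t = d_n + y/c_n then absorbs its factor n into
  \<open>rescaled_density\<close>.\<close>

lemma pair_sum_cdf_tendsto: "(\<lambda>n. pair_sum_cdf n (2 * d_seq n + z / c_seq n)) \<longlonglongrightarrow> limit_cdf z"
proof -
  have "\<forall>\<^sub>F n in sequentially. gauss_cdf (d_seq n + (z/2) / c_seq n) ^ n +
     (LINT y|lborel. indicator {z/2<..} y * gauss_cdf (d_seq n + (z - y) / c_seq n) ^ (n - 1) * rescaled_density n y) =
     pair_sum_cdf n (2 * d_seq n + z / c_seq n)"
    using eventually_ge_at_top[of 2]
  proof eventually_elim
    case (elim n)
    define w where "w = 2 * d_seq n + z / c_seq n"
    have c: "c_seq n > 0" by (rule c_seq_pos[OF elim])
    have w2: "w/2 = d_seq n + (z/2) / c_seq n" by (simp add: w_def add_divide_distrib)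
    have iff: "(\<forall>p\<in>pairs n. x (fst p) + x (snd p) \<le> w) \<longleftrightarrow> (\<forall>i\<in>{1..n}. \<forall>j\<in>{1..n}. i \<noteq> j \<longrightarrow> x i + x j \<le> w)" for x :: "nat \<Rightarrow> real"
    proof (intro iffI ballI impI)
      fix i j assume h: "\<forall>p\<in>pairs n. x (fst p) + x (snd p) \<le> w" "i \<in> {1..n}" "j \<in> {1..n}" "i \<noteq> j"
      have "(min i j, max i j) \<in> pairs n" using h(2-4) by (auto simp: pairs_def min_def max_def)
      with h(1) have "x (min i j) + x (max i j) \<le> w" by fastforce
      thus "x i + x j \<le> w" by (auto simp: min_def max_def add.commute split: if_splits)
    qed (auto simp: pairs_def)
    have "pair_sum_cdf n w = gauss_cdf (w/2) ^ card {1..n} +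
        real (card {1..n}) * (LINT t|std_normal_distribution. indicator {w/2<..} t * gauss_cdf (w - t) ^ (card {1..n} - 1))"
      unfolding pair_sum_cdf_def iff by (rule measure_PiM_pair_sums_le[OF real_dist_normal_dist]) simp
    also have "\<dots> = gauss_cdf (w/2) ^ n + real n * (LINT t|std_normal_distribution. indicator {w/2<..} t * gauss_cdf (w - t) ^ (n - 1))"
      by simp
    also have "real n * (LINT t|std_normal_distribution. indicator {w/2<..} t * gauss_cdf (w - t) ^ (n - 1)) =
       (LINT y|lborel. (indicator {w/2<..} (d_seq n + y / c_seq n) * gauss_cdf (w - (d_seq n + y / c_seq n)) ^ (n - 1)) * rescaled_density n y)"
    proof (rule integral_std_normal_rescale[where f="\<lambda>t. indicator {w/2<..} t * gauss_cdf (w - t) ^ (n - 1)"])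
      show "(\<lambda>t. indicator {w/2<..} t * gauss_cdf (w - t) ^ (n - 1)) \<in> borel_measurable borel"
        by (intro borel_measurable_times borel_measurable_indicator borel_measurable_power
            measurable_compose[OF _ gauss_cdf_measurable] borel_measurable_diff) simp_all
    qed (use elim in \<open>auto simp: std_normal.cdf_nonneg\<close>)
    also have "\<dots> = (LINT y|lborel. indicator {z/2<..} y * gauss_cdf (d_seq n + (z - y) / c_seq n) ^ (n - 1) * rescaled_density n y)"
    proof (intro Bochner_Integration.integral_cong refl)
      fix y
      have arg: "w - (d_seq n + y / c_seq n) = d_seq n + (z - y) / c_seq n"
        by (simp add: w_def diff_divide_distrib)
      have thr: "w/2 < d_seq n + y / c_seq n \<longleftrightarrow> z/2 < y"
        unfolding w2 add_less_cancel_left divide_less_cancel using c by simp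
      show "indicator {w/2<..} (d_seq n + y / c_seq n) * gauss_cdf (w - (d_seq n + y / c_seq n)) ^ (n - 1) * rescaled_density n y =
        indicator {z/2<..} y * gauss_cdf (d_seq n + (z - y) / c_seq n) ^ (n - 1) * rescaled_density n y"
        unfolding arg using thr by (auto simp only: indicator_def greaterThan_iff)
    qed
    finally show ?case unfolding w2 by (simp only: w_def)
  qed
  with top_two_sum_tendsto[of z] show ?thesis by (rule Lim_transform_eventually)
qed

definition model_cdf :: "real \<Rightarrow> nat \<Rightarrow> real \<Rightarrow> real" where
  "model_cdf r n u = measure (model_space n) {\<omega> \<in> space (model_space n). \<forall>p\<in>pairs n. model_field r p \<omega> \<le> u}"

text \<open>The joint characteristic functions of the field and of the model coincide, and these
  determine the probability of the box below u.\<close>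

lemma gaussian_field_cdf_eq:
  assumes M: "prob_space M" and r: "0 \<le> r" "r \<le> 1/2"
    and G: "centered_gaussian_field M (pairs n) G (cov_r r)"
  shows "measure M {\<omega> \<in> space M. \<forall>p\<in>pairs n. G p \<omega> \<le> u} = model_cdf r n u"
proof -
  interpret X: prob_space "gauss_space {1..n}" by (rule prob_space_gauss_space)
  interpret Z: prob_space "gauss_space (pairs n)" by (rule prob_space_gauss_space)
  interpret XZ: pair_prob_space "gauss_space {1..n}" "gauss_space (pairs n)" ..
  have "measure M {\<omega> \<in> space M. \<forall>p\<in>pairs n. G p \<omega> \<in> {..u}} =
     measure (model_space n) {\<omega> \<in> space (model_space n). \<forall>p\<in>pairs n. model_field r p \<omega> \<in> {..u}}"
  proof (rule joint_char_unique[OF M XZ.P.prob_space_axioms finite_pairs])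
    fix a :: "nat \<times> nat \<Rightarrow> real"
    show "(LINT x|M. cis (\<Sum>p\<in>pairs n. a p * G p x)) = (LINT x|model_space n. cis (\<Sum>p\<in>pairs n. a p * model_field r p x))"
      using G unfolding model_field_char[OF r] centered_gaussian_field_def by blast
  next
    show "G p \<in> borel_measurable M" if "p \<in> pairs n" for p
      using G that unfolding centered_gaussian_field_def by blast
    show "model_field r p \<in> borel_measurable (model_space n)" if "p \<in> pairs n" for p
      using that by (rule model_field_measurable)
  qed simp
  thus ?thesis by (simp only: model_cdf_def atMost_iff)
qed

lemma cdf_gaussian_field_max:
  assumes M: "prob_space M" and r: "0 \<le> r" "r \<le> 1/2" and n: "n \<ge> 2"
    and G: "centered_gaussian_field M (pairs n) G (cov_r r)"
  shows "cdf (distr M borel (\<lambda>\<omega>. c_seq n * (Max ((\<lambda>p. G p \<omega>) ` pairs n) - sqrt 2 * d_seq n))) x =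
    model_cdf r n (sqrt 2 * d_seq n + x / c_seq n)"
proof -
  \<comment> \<open>\<open>Max\<close> is meaningful for nonempty sets only; n >= 2 supplies the
    pair (1, 2).\<close>
  have ne: "pairs n \<noteq> {}"
  proof -
    have "(1, 2) \<in> pairs n" using n by (simp add: pairs_def)
    thus ?thesis by blast
  qed
  have Gm: "G p \<in> borel_measurable M" if "p \<in> pairs n" for p
    using G that unfolding centered_gaussian_field_def by blast
  have mm: "(\<lambda>\<omega>. Max ((\<lambda>p. G p \<omega>) ` pairs n)) \<in> borel_measurable M"
    by (intro borel_measurable_Max finite_pairs Gm)
  have m: "(\<lambda>\<omega>. c_seq n * (Max ((\<lambda>p. G p \<omega>) ` pairs n) - sqrt 2 * d_seq n)) \<in> borel_measurable M"
    by (intro borel_measurable_times borel_measurable_diff borel_measurable_const mm)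
  have iff: "c_seq n * (Max ((\<lambda>p. G p \<omega>) ` pairs n) - sqrt 2 * d_seq n) \<le> x \<longleftrightarrow>
      (\<forall>p\<in>pairs n. G p \<omega> \<le> sqrt 2 * d_seq n + x / c_seq n)" for \<omega>
  proof -
    have "c_seq n * (Max ((\<lambda>p. G p \<omega>) ` pairs n) - sqrt 2 * d_seq n) \<le> x \<longleftrightarrow>
        Max ((\<lambda>p. G p \<omega>) ` pairs n) \<le> sqrt 2 * d_seq n + x / c_seq n"
      using c_seq_pos[OF n] by (auto simp: field_simps)
    also have "\<dots> \<longleftrightarrow> (\<forall>p\<in>pairs n. G p \<omega> \<le> sqrt 2 * d_seq n + x / c_seq n)"
      using ne finite_pairs by simp
    finally show ?thesis .
  qed
  have "cdf (distr M borel (\<lambda>\<omega>. c_seq n * (Max ((\<lambda>p. G p \<omega>) ` pairs n) - sqrt 2 * d_seq n))) x =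
      measure M ((\<lambda>\<omega>. c_seq n * (Max ((\<lambda>p. G p \<omega>) ` pairs n) - sqrt 2 * d_seq n)) -` {..x} \<inter> space M)"
    unfolding cdf_def by (rule measure_distr[OF m]) simp
  also have "(\<lambda>\<omega>. c_seq n * (Max ((\<lambda>p. G p \<omega>) ` pairs n) - sqrt 2 * d_seq n)) -` {..x} \<inter> space M =
      {\<omega> \<in> space M. \<forall>p\<in>pairs n. G p \<omega> \<le> sqrt 2 * d_seq n + x / c_seq n}"
    unfolding iff[symmetric] by blast
  finally show ?thesis unfolding gaussian_field_cdf_eq[OF M r G] .
qed

section \<open>Asymptotic comparison with an epsilon of room\<close>

lemma c_seq_sq_mult_tendsto_0:
  assumes "(\<lambda>n. f n * ln (real n)) \<longlonglongrightarrow> 0"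
  shows "(\<lambda>n. (c_seq n)\<^sup>2 * f n) \<longlonglongrightarrow> 0"
proof (rule Lim_transform_eventually)
  show "(\<lambda>n. 2 * (f n * ln (real n))) \<longlonglongrightarrow> 0"
    using tendsto_mult_left[OF assms, of 2] by simp
  show "\<forall>\<^sub>F n in sequentially. 2 * (f n * ln (real n)) = (c_seq n)\<^sup>2 * f n"
    using eventually_ge_at_top[of 2] by eventually_elim (simp add: c_seq_sq)
qed

lemma inverse_c_seq_sq_tendsto_0: "(\<lambda>n. inverse ((c_seq n)\<^sup>2)) \<longlonglongrightarrow> 0"
  by (intro tendsto_inverse_0_at_top filterlim_pow_at_top c_seq_at_top) simp

lemma exp_neg_mult_tendsto_0: "0 < (a::real) \<Longrightarrow> ((\<lambda>t. exp (- (t * a))) \<longlongrightarrow> 0) at_top"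
  by real_asymp

text \<open>Once a vertex sum exceeds the level shifted by \<epsilon>, the noise has to undo a
  rescaled gap \<open>E n\<close> that tends to \<epsilon>. At rate A c_n the Chernoff bound is exp
  (- A E n + A^2 k n / 2), with limit exp (- A \<epsilon>), small for large A. The factor sqrt 2 in
  the argument of \<open>limit_cdf\<close> is there because the field is close to (X_i + X_j) / sqrt
  2.\<close>

lemma eventually_model_cdf_less:
  fixes r :: "nat \<Rightarrow> real"
  assumes r: "\<And>n. n \<ge> 2 \<Longrightarrow> 0 \<le> r n \<and> r n \<le> 1/2"
    and lim: "(\<lambda>n. (1 - 2 * r n) * ln (real n)) \<longlonglongrightarrow> 0"
    and \<epsilon>: "\<epsilon> > 0" and y: "limit_cdf (sqrt 2 * (x + \<epsilon>)) < y"
  shows "\<forall>\<^sub>F n in sequentially. model_cdf (r n) n (sqrt 2 * d_seq n + x / c_seq n) < y"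
proof -
  define L where "L = limit_cdf (sqrt 2 * (x + \<epsilon>))"
  \<comment> \<open>Relative loss of the vertex part against r = 1/2: sqrt r = (1 - b) / sqrt
    2.\<close>
  define b where "b n = 1 - sqrt (2 * r n)" for n
  define k where "k n = (c_seq n)\<^sup>2 * (1 - 2 * r n)" for n
  have k0: "k \<longlonglongrightarrow> 0" unfolding k_def by (rule c_seq_sq_mult_tendsto_0[OF lim])
  \<comment> \<open>The upper bound is sqrt s >= s for s = 2r in [0, 1].\<close>
  have b: "0 \<le> b n \<and> b n \<le> 1 - 2 * r n" if "n \<ge> 2" for n
  proof -
    have r': "0 \<le> 2 * r n" "2 * r n \<le> 1" using r[OF that] by auto
    have "sqrt (2 * r n) \<le> 1" using r' by simp
    moreover have "2 * r n = sqrt (2 * r n) * sqrt (2 * r n)" using r' by simp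
    moreover have "sqrt (2 * r n) * sqrt (2 * r n) \<le> sqrt (2 * r n) * 1"
      using r' by (intro mult_left_mono) auto
    ultimately show ?thesis by (simp add: b_def)
  qed
  have bc: "(\<lambda>n. (c_seq n)\<^sup>2 * b n) \<longlonglongrightarrow> 0"
  proof (rule tendsto_sandwich[OF _ _ tendsto_const k0])
    show "\<forall>\<^sub>F n in sequentially. 0 \<le> (c_seq n)\<^sup>2 * b n"
      using eventually_ge_at_top[of 2] by eventually_elim (simp add: b)
    show "\<forall>\<^sub>F n in sequentially. (c_seq n)\<^sup>2 * b n \<le> k n"
      using eventually_ge_at_top[of 2] by eventually_elim (auto simp: b k_def intro!: mult_left_mono)
  qed
  have b0: "b \<longlonglongrightarrow> 0"
  proof -
    have "(\<lambda>n. ((c_seq n)\<^sup>2 * b n) * inverse ((c_seq n)\<^sup>2)) \<longlonglongrightarrow> 0 * 0"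
      by (intro tendsto_mult bc inverse_c_seq_sq_tendsto_0)
    moreover have "\<forall>\<^sub>F n in sequentially. ((c_seq n)\<^sup>2 * b n) * inverse ((c_seq n)\<^sup>2) = b n"
      using eventually_ge_at_top[of 2]
    proof eventually_elim
      case (elim n)
      thus ?case using c_seq_pos[of n] by simp
    qed
    ultimately have "b \<longlonglongrightarrow> 0 * 0" by (rule Lim_transform_eventually)
    thus ?thesis by simp
  qed
  obtain A where A: "A \<ge> 0" "L + exp (- (A * \<epsilon>)) < y"
  proof -
    have "((\<lambda>A. L + exp (- (A * \<epsilon>))) \<longlongrightarrow> L + 0) at_top"
      by (intro tendsto_add tendsto_const exp_neg_mult_tendsto_0 \<epsilon>)
    moreover have "L + 0 < y" using y by (simp add: L_def)
    ultimately have "\<forall>\<^sub>F A in at_top. L + exp (- (A * \<epsilon>)) < y" by (rule order_tendstoD(2))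
    hence "\<forall>\<^sub>F A in at_top. A \<ge> 0 \<and> L + exp (- (A * \<epsilon>)) < y"
      using eventually_ge_at_top[of 0] by eventually_elim simp
    then obtain A0 where "\<forall>A\<ge>A0. A \<ge> 0 \<and> L + exp (- (A * \<epsilon>)) < y"
      unfolding eventually_at_top_linorder by blast
    thus ?thesis using that[of A0] by simp
  qed
  \<comment> \<open>This is c_n (sqrt r * v - u): the shift \<epsilon> minus the loss due to
    \<open>b\<close>. The leading loss is of order c_n d_n b, so b -> 0 alone is not enough and
    c_n^2 b -> 0 is used.\<close>
  define E where "E n = \<epsilon> - (sqrt 2 * ((c_seq n)\<^sup>2 * b n * (d_seq n / c_seq n)) + b n * (x + \<epsilon>))" for n
  have E: "E \<longlonglongrightarrow> \<epsilon> - (sqrt 2 * (0 * 1) + 0 * (x + \<epsilon>))"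
    unfolding E_def by (intro tendsto_intros bc d_over_c_tendsto b0)
  define U where "U n = pair_sum_cdf n (2 * d_seq n + sqrt 2 * (x + \<epsilon>) / c_seq n) + exp (- A * E n + A\<^sup>2 * k n / 2)" for n
  have "U \<longlonglongrightarrow> L + exp (- A * (\<epsilon> - (sqrt 2 * (0 * 1) + 0 * (x + \<epsilon>))) + A\<^sup>2 * 0 / 2)"
    unfolding U_def L_def by (intro tendsto_intros pair_sum_cdf_tendsto E k0) simp
  hence "U \<longlonglongrightarrow> L + exp (- (A * \<epsilon>))" by simp
  from order_tendstoD(2)[OF this A(2)] show ?thesis using eventually_ge_at_top[of 2]
  proof eventually_elim
    case (elim n)
    have c: "c_seq n > 0" using c_seq_pos elim by simp
    define v where "v = 2 * d_seq n + sqrt 2 * (x + \<epsilon>) / c_seq n"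
    define u where "u = sqrt 2 * d_seq n + x / c_seq n"
    have r': "0 \<le> r n" "r n \<le> 1/2" using r[OF elim(2)] by auto
    have "model_cdf (r n) n u \<le> pair_sum_cdf n v
        + exp (- (A * c_seq n) * (sqrt (r n) * v - u) + (A * c_seq n)\<^sup>2 * (1 - 2 * r n) / 2)"
      unfolding model_cdf_def pair_sum_cdf_def
      using A(1) c by (intro model_cdf_upper r') simp
    also have "(A * c_seq n)\<^sup>2 * (1 - 2 * r n) / 2 = A\<^sup>2 * k n / 2"
      by (simp add: k_def power_mult_distrib)
    also have "- (A * c_seq n) * (sqrt (r n) * v - u) = - A * E n"
    proof -
      have v: "v = sqrt 2 * (sqrt 2 * d_seq n + (x + \<epsilon>) / c_seq n)"
        by (simp add: v_def distrib_left)
      have "sqrt (r n) * v = (1 - b n) * (sqrt 2 * d_seq n + (x + \<epsilon>) / c_seq n)"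
        unfolding v b_def by (simp add: real_sqrt_mult)
      hence "c_seq n * (sqrt (r n) * v - u) =
          (1 - b n) * (sqrt 2 * (c_seq n * d_seq n) + c_seq n * ((x + \<epsilon>) / c_seq n)) - (sqrt 2 * (c_seq n * d_seq n) + c_seq n * (x / c_seq n))"
        by (simp only: u_def) (simp only: right_diff_distrib distrib_left mult.left_commute)
      also have "\<dots> = (1 - b n) * (sqrt 2 * (c_seq n * d_seq n) + (x + \<epsilon>)) - (sqrt 2 * (c_seq n * d_seq n) + x)"
        using c by simp
      also have "\<dots> = \<epsilon> - (sqrt 2 * (b n * (c_seq n * d_seq n)) + b n * (x + \<epsilon>))"
        by (simp add: algebra_simps)
      also have "b n * (c_seq n * d_seq n) = (c_seq n)\<^sup>2 * b n * (d_seq n / c_seq n)"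
        using c by (simp add: power2_eq_square)
      finally have "c_seq n * (sqrt (r n) * v - u) = E n" by (simp only: E_def)
      thus ?thesis by (simp only: mult_minus_left mult.assoc)
    qed
    finally have "model_cdf (r n) n u \<le> U n" by (simp add: U_def v_def)
    thus ?case using elim(1) by (simp add: u_def)
  qed
qed

text \<open>The order of choices matters: K makes a coordinate above K unlikely, D bounds the moment
  truncated at K + 1 and so depends on K, and B is then taken large enough to beat D^2. Each of the
  two extra error terms uses less than half of the gap L - y.\<close>

lemma eventually_model_cdf_greater:
  fixes r :: "nat \<Rightarrow> real"
  assumes r: "\<And>n. n \<ge> 2 \<Longrightarrow> 0 \<le> r n \<and> r n \<le> 1/2"
    and lim: "(\<lambda>n. (1 - 2 * r n) * ln (real n)) \<longlonglongrightarrow> 0"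
    and \<epsilon>: "\<epsilon> > 0" and y: "y < limit_cdf (sqrt 2 * (x - \<epsilon>))"
  shows "\<forall>\<^sub>F n in sequentially. y < model_cdf (r n) n (sqrt 2 * d_seq n + x / c_seq n)"
proof -
  define L where "L = limit_cdf (sqrt 2 * (x - \<epsilon>))"
  define k where "k n = (c_seq n)\<^sup>2 * (1 - 2 * r n)" for n
  have k0: "k \<longlonglongrightarrow> 0" unfolding k_def by (rule c_seq_sq_mult_tendsto_0[OF lim])
  \<comment> \<open>As c_n tends to infinity, the hypothesis forces r -> 1/2; so r is eventually
    positive and division by it is legitimate.\<close>
  have r0: "r \<longlonglongrightarrow> 1/2"
  proof -
    have "(\<lambda>n. (1 - k n * inverse ((c_seq n)\<^sup>2)) / 2) \<longlonglongrightarrow> (1 - 0 * 0) / 2" by (intro tendsto_intros k0 inverse_c_seq_sq_tendsto_0) simp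
    moreover have "\<forall>\<^sub>F n in sequentially. (1 - k n * inverse ((c_seq n)\<^sup>2)) / 2 = r n"
      using eventually_ge_at_top[of 2]
    proof eventually_elim
      case (elim n)
      thus ?case using c_seq_pos[of n] by (simp add: k_def field_simps)
    qed
    ultimately show ?thesis by (auto dest: Lim_transform_eventually)
  qed
  have gap: "L - y > 0" using y by (simp add: L_def)
  obtain K where K: "exp (- K) < (L - y) / 2"
  proof -
    have "((\<lambda>K::real. exp (- (K * 1))) \<longlongrightarrow> 0) at_top" by (rule exp_neg_mult_tendsto_0) simp
    from order_tendstoD(2)[OF this, of "(L - y) / 2"] gap
    obtain K where "exp (- (K * 1)) < (L - y) / 2"
      unfolding eventually_at_top_linorder by auto
    thus ?thesis using that by simp
  qed
  \<comment> \<open>K + 1 here against K in the tail estimate provides the strict inequality of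
    truncation levels in \<open>model_cdf_lower\<close>.\<close>
  define q where "q n = (LINT t|std_normal_distribution. indicator {..<d_seq n + (K + 1) / c_seq n} t * exp (2 * (c_seq n * (t - d_seq n))))" for n
  obtain D where D: "\<forall>\<^sub>F n in sequentially. real n * q n \<le> D"
    using truncated_exp_moment_bounded[of "K + 1"] unfolding q_def by blast
  obtain B where B: "B \<ge> 2" "exp (- ((B - 2) * (sqrt 2 * \<epsilon>)) - 2 * sqrt 2 * x) * D\<^sup>2 < (L - y) / 2"
  proof -
    have "((\<lambda>B. exp (- (B * (sqrt 2 * \<epsilon>))) * (exp (2 * (sqrt 2 * \<epsilon>) - 2 * sqrt 2 * x) * D\<^sup>2)) \<longlongrightarrow> 0 * (exp (2 * (sqrt 2 * \<epsilon>) - 2 * sqrt 2 * x) * D\<^sup>2)) at_top"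
      using \<epsilon> by (intro tendsto_mult tendsto_const exp_neg_mult_tendsto_0) simp
    from order_tendstoD(2)[OF this, of "(L - y) / 2"] gap
    have "\<forall>\<^sub>F B in at_top. exp (- (B * (sqrt 2 * \<epsilon>))) * (exp (2 * (sqrt 2 * \<epsilon>) - 2 * sqrt 2 * x) * D\<^sup>2) < (L - y) / 2"
      by simp
    hence "\<forall>\<^sub>F B in at_top. B \<ge> 2 \<and> exp (- (B * (sqrt 2 * \<epsilon>))) * (exp (2 * (sqrt 2 * \<epsilon>) - 2 * sqrt 2 * x) * D\<^sup>2) < (L - y) / 2"
      using eventually_ge_at_top[of 2] by eventually_elim simp
    then obtain B where B: "B \<ge> 2" "exp (- (B * (sqrt 2 * \<epsilon>))) * (exp (2 * (sqrt 2 * \<epsilon>) - 2 * sqrt 2 * x) * D\<^sup>2) < (L - y) / 2"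
      unfolding eventually_at_top_linorder by blast
    have "- ((B - 2) * (sqrt 2 * \<epsilon>)) - 2 * sqrt 2 * x = - (B * (sqrt 2 * \<epsilon>)) + (2 * (sqrt 2 * \<epsilon>) - 2 * sqrt 2 * x)"
      by (simp add: algebra_simps)
    hence e: "exp (- ((B - 2) * (sqrt 2 * \<epsilon>)) - 2 * sqrt 2 * x) * D\<^sup>2 =
        exp (- (B * (sqrt 2 * \<epsilon>))) * (exp (2 * (sqrt 2 * \<epsilon>) - 2 * sqrt 2 * x) * D\<^sup>2)"
      by (simp only: exp_add mult.assoc)
    show ?thesis by (rule that[OF B(1)]) (simp only: e B(2))
  qed
  define V where "V n = (1 - pair_sum_cdf n (2 * d_seq n + sqrt 2 * (x - \<epsilon>) / c_seq n))
     + real n * (1 - gauss_cdf (d_seq n + K / c_seq n))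
     + exp (B\<^sup>2 * k n / (2 * r n) - (B - 2) * (sqrt 2 * \<epsilon>) - 2 * sqrt 2 * x) * D\<^sup>2" for n
  have "V \<longlonglongrightarrow> (1 - L) + exp (- K) + exp (B\<^sup>2 * 0 / (2 * (1/2)) - (B - 2) * (sqrt 2 * \<epsilon>) - 2 * sqrt 2 * x) * D\<^sup>2"
    unfolding V_def L_def
    by (intro tendsto_intros pair_sum_cdf_tendsto gauss_tail_tendsto k0 r0) simp_all
  moreover have "(1 - L) + exp (- K) + exp (B\<^sup>2 * 0 / (2 * (1/2)) - (B - 2) * (sqrt 2 * \<epsilon>) - 2 * sqrt 2 * x) * D\<^sup>2 < 1 - y"
    using K B(2) by simp
  ultimately have V: "\<forall>\<^sub>F n in sequentially. V n < 1 - y" by (rule order_tendstoD)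
  \<comment> \<open>Chosen to make u nonnegative: d_n >= c_n/2 >= 1 and x/c_n >= -1.\<close>
  have cbig: "\<forall>\<^sub>F n in sequentially. c_seq n \<ge> max 2 \<bar>x\<bar>"
    using c_seq_at_top unfolding filterlim_at_top by blast
  have rpos: "\<forall>\<^sub>F n in sequentially. 0 < r n"
    using order_tendstoD(1)[OF r0, of 0] by simp
  show ?thesis
    using V cbig rpos D d_over_c_bounds eventually_ge_at_top[of 2]
  proof eventually_elim
    case (elim n)
    define u where "u = sqrt 2 * d_seq n + x / c_seq n"
    have c: "c_seq n > 0" using c_seq_pos elim by simp
    have u0: "u \<ge> 0"
    proof -
      have "d_seq n \<ge> 1" using elim c by (simp add: field_simps)
      moreover have "1 \<le> sqrt (2::real)" by simp
      ultimately have "1 * 1 \<le> sqrt 2 * d_seq n" by (intro mult_mono) auto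
      moreover have "- 1 * c_seq n \<le> x" using elim by auto
      hence "- 1 \<le> x / c_seq n" using c by (simp only: pos_le_divide_eq)
      ultimately show ?thesis by (simp add: u_def)
    qed
    have "1 - model_cdf (r n) n u \<le> (1 - pair_sum_cdf n (2 * d_seq n + sqrt 2 * (x - \<epsilon>) / c_seq n))
       + real n * (1 - gauss_cdf (d_seq n + K / c_seq n))
       + exp (B\<^sup>2 * ((c_seq n)\<^sup>2 * (1 - 2 * r n)) / (2 * r n) - (B - 2) * (sqrt 2 * \<epsilon>) - 2 * sqrt 2 * x) * (real n * q n)\<^sup>2"
      unfolding model_cdf_def pair_sum_cdf_def q_def
    proof (rule model_cdf_lower)
      show "d_seq n + K / c_seq n < d_seq n + (K + 1) / c_seq n" using c by (simp add: divide_strict_right_mono)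
    qed (use elim c B(1) r[of n] u0 in \<open>auto simp: u_def\<close>)
    also have "\<dots> \<le> V n"
    proof -
      have "q n \<ge> 0" unfolding q_def by (intro Bochner_Integration.integral_nonneg) auto
      hence "(real n * q n)\<^sup>2 \<le> D\<^sup>2" using elim by (intro power_mono) auto
      thus ?thesis unfolding V_def k_def by (intro add_left_mono mult_left_mono) auto
    qed
    finally show ?case using elim(1) by (simp add: u_def)
  qed
qed

theorem theorem2p3:
  fixes M :: "nat \<Rightarrow> 'a measure"
    and G :: "nat \<Rightarrow> nat \<times> nat \<Rightarrow> 'a \<Rightarrow> real"
    and r :: "nat \<Rightarrow> real"
    and N :: "'b measure"
    and \<zeta> :: "nat \<Rightarrow> 'b \<Rightarrow> real"
  assumes probM: "\<And>n. n \<ge> 2 \<Longrightarrow> prob_space (M n)"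
    and r_range: "\<And>n. n \<ge> 2 \<Longrightarrow> 0 \<le> r n \<and> r n \<le> 1/2"
    and gauss: "\<And>n. n \<ge> 2 \<Longrightarrow> centered_gaussian_field (M n) (pairs n) (G n) (cov_r (r n))"
    and r_lim: "(\<lambda>n. (1 - 2 * r n) * ln (real n)) \<longlonglongrightarrow> 0"
    and probN: "prob_space N"
    and zeta_indep: "prob_space.indep_vars N (\<lambda>_. borel) \<zeta> {1..}"
    and zeta_exp: "\<And>k. k \<ge> 1 \<Longrightarrow> distributed N lborel (\<zeta> k) (exponential_density 1)"
  shows "weak_conv_m
           (\<lambda>n. distr (M n) borel
                   (\<lambda>\<omega>. c_seq n * (Max ((\<lambda>p. G n p \<omega>) ` pairs n) - sqrt 2 * d_seq n)))
           (distr N borel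
                   (\<lambda>\<omega>. ((- ln (\<Sum>k=1..1. \<zeta> k \<omega>)) + (- ln (\<Sum>k=1..2. \<zeta> k \<omega>))) / sqrt 2))"
proof -
  have cdf_N: "cdf (distr N borel (\<lambda>\<omega>. ((- ln (\<Sum>k=1..1. \<zeta> k \<omega>)) + (- ln (\<Sum>k=1..2. \<zeta> k \<omega>))) / sqrt 2)) =
      (\<lambda>x. limit_cdf (sqrt 2 * x))"
    by (intro ext prob_space.cdf_log_gamma_sum[OF probN zeta_indep zeta_exp])
  show ?thesis
    unfolding weak_conv_m_def weak_conv_def cdf_N
  proof (intro allI impI)
    fix x assume cont: "isCont (\<lambda>x. limit_cdf (sqrt 2 * x)) x"
    \<comment> \<open>Weak convergence is tested at continuity points of the limit. Continuity at x
      keeps the values shifted by a small \<epsilon> on either side within any neighbourhood of the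
      unshifted one.\<close>
    have near: "\<exists>\<epsilon>>0. P (limit_cdf (sqrt 2 * (x + \<epsilon>))) \<and> P (limit_cdf (sqrt 2 * (x - \<epsilon>)))"
      if P: "\<forall>\<^sub>F l in nhds (limit_cdf (sqrt 2 * x)). P l" for P
    proof -
      have "((\<lambda>x. limit_cdf (sqrt 2 * x)) \<longlongrightarrow> limit_cdf (sqrt 2 * x)) (nhds x)"
        using cont unfolding isCont_def
        by (rule tendsto_at_iff_tendsto_nhds[where g="\<lambda>x. limit_cdf (sqrt 2 * x)" and l=x, THEN iffD1])
      with P have "\<forall>\<^sub>F t in nhds x. P (limit_cdf (sqrt 2 * t))"
        unfolding filterlim_iff by blast
      then obtain e where e: "e > 0" "\<And>t. dist t x < e \<Longrightarrow> P (limit_cdf (sqrt 2 * t))"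
        unfolding eventually_nhds_metric by blast
      show ?thesis
        using e(1) by (intro exI[of _ "e/2"] conjI e(2)) (auto simp: dist_real_def)
    qed
    have lim: "(\<lambda>n. model_cdf (r n) n (sqrt 2 * d_seq n + x / c_seq n)) \<longlonglongrightarrow> limit_cdf (sqrt 2 * x)"
    proof (rule order_tendstoI)
      fix y assume "y < limit_cdf (sqrt 2 * x)"
      hence "\<forall>\<^sub>F l in nhds (limit_cdf (sqrt 2 * x)). y < l"
        using eventually_nhds_in_open[of "{y<..}" "limit_cdf (sqrt 2 * x)"] by simp
      from near[OF this] obtain \<epsilon> where "\<epsilon> > 0" "y < limit_cdf (sqrt 2 * (x - \<epsilon>))" by blast
      with r_range r_lim show "\<forall>\<^sub>F n in sequentially. y < model_cdf (r n) n (sqrt 2 * d_seq n + x / c_seq n)"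
        by (rule eventually_model_cdf_greater)
    next
      fix y assume "limit_cdf (sqrt 2 * x) < y"
      hence "\<forall>\<^sub>F l in nhds (limit_cdf (sqrt 2 * x)). l < y"
        using eventually_nhds_in_open[of "{..<y}" "limit_cdf (sqrt 2 * x)"] by simp
      from near[OF this] obtain \<epsilon> where "\<epsilon> > 0" "limit_cdf (sqrt 2 * (x + \<epsilon>)) < y" by blast
      with r_range r_lim show "\<forall>\<^sub>F n in sequentially. model_cdf (r n) n (sqrt 2 * d_seq n + x / c_seq n) < y"
        by (rule eventually_model_cdf_less)
    qed
    show "(\<lambda>n. cdf (distr (M n) borel (\<lambda>\<omega>. c_seq n * (Max ((\<lambda>p. G n p \<omega>) ` pairs n) - sqrt 2 * d_seq n))) x)
        \<longlonglongrightarrow> limit_cdf (sqrt 2 * x)"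
    proof (rule Lim_transform_eventually[OF lim])
      show "\<forall>\<^sub>F n in sequentially. model_cdf (r n) n (sqrt 2 * d_seq n + x / c_seq n) =
          cdf (distr (M n) borel (\<lambda>\<omega>. c_seq n * (Max ((\<lambda>p. G n p \<omega>) ` pairs n) - sqrt 2 * d_seq n))) x"
        using eventually_ge_at_top[of 2]
      proof eventually_elim
        case (elim n)
        show ?case
          using r_range[OF elim] by (intro cdf_gaussian_field_max[symmetric] probM[OF elim] gauss[OF elim] elim) auto
      qed
    qed
  qed
qed

end
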